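(* Let $H$ be a complex Hilbert space and let $A \in B(H)$ be a compact operator. Then the following conditions are equivalent. (A1) $A$ is a (scalar) multiple of a positive semi-definite operator. (A2) $\sigma(AB) \subseteq \overline{W(A)W(B)}$ for all $B \in B(H)$. (A3) $\sigma(AB) \subseteq \overline{W(A)W(B)}$ for all rank one $B \in B(H)$.
   Context: $B(H)$ is the algebra of bounded linear operators on a complex Hilbert space $H$ (of finite or infinite dimension). For $A\in B(H)$, $\sigma(A)=\{\lambda\in\mathbb{C}: A-\lambda I \text{ is not invertible}\}$ is the spectrum and $W(A)=\{\langle Ax,x\rangle : x\in H,\ \|x\|=1\}$ is the numerical range. For sets $S,T\subseteq\mathbb{C}$, $ST=\{st: s\in S,\ t\in T\}$, and $\overline{S}$ denotes the closure of $S$. "A multiple of a positive semi-definite operator" means an operator of the form $\gamma P$ with $\gamma\in\mathbb{C}$ and $P\in B(H)$ positive semi-definite. *)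

theory Defs
  imports "HOL-Analysis.Analysis" "HOL-Library.Set_Algebras"
begin

text \<open>
  Complex Hilbert spaces are set up on top of the real type classes, so that norm, topology and
  completeness are those of the library: a complex inner product space is a real one whose scalar
  multiplication extends to the complex numbers and whose real inner product is the real part of a
  sesquilinear form.  Positive definiteness and \<open>norm x = sqrt (Re (cinner x x))\<close> are inherited
  from \<^class>\<open>real_inner\<close>.
\<close>

class complex_vector = real_vector +
  fixes scaleC :: "complex \<Rightarrow> 'a \<Rightarrow> 'a"  (infixr "*\<^sub>C" 75)
  assumes scaleC_add_right: "a *\<^sub>C (x + y) = a *\<^sub>C x + a *\<^sub>C y"
    and scaleC_add_left: "(a + b) *\<^sub>C x = a *\<^sub>C x + b *\<^sub>C x"
    and scaleC_scaleC: "a *\<^sub>C (b *\<^sub>C x) = (a * b) *\<^sub>C x"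
    and scaleR_scaleC: "r *\<^sub>R x = complex_of_real r *\<^sub>C x"

text \<open>
  The form is linear in its first argument.  This matters: with the opposite convention the
  numerical range below would be replaced by its complex conjugate, the spectrum would not.
\<close>

class complex_inner = complex_vector + real_inner +
  fixes cinner :: "'a \<Rightarrow> 'a \<Rightarrow> complex"
  assumes cinner_commute: "cinner x y = cnj (cinner y x)"
    and cinner_add_left: "cinner (x + y) z = cinner x z + cinner y z"
    and cinner_scaleC_left: "cinner (c *\<^sub>C x) y = c * cinner x y"
    and inner_eq_Re_cinner: "inner x y = Re (cinner x y)"

class complex_hilbert_space = complex_inner + complete_space

lemma vector_space_scaleC: "vector_space (scaleC :: complex \<Rightarrow> 'a \<Rightarrow> 'a::complex_vector)"
proof
  show "1 *\<^sub>C x = x" for x :: 'a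
    using scaleR_scaleC[of 1 x] by simp
qed (simp_all add: scaleC_add_right scaleC_add_left scaleC_scaleC)

lemma cinner_self: "cinner x x = complex_of_real ((norm x)\<^sup>2)"
  for x :: "'a::complex_inner"
proof (rule complex_eqI)
  have "Im (cinner x x) = - Im (cinner x x)"
    using arg_cong[OF cinner_commute[of x x], of Im] by simp
  then show "Im (cinner x x) = Im (complex_of_real ((norm x)\<^sup>2))"
    by simp
qed (simp add: power2_norm_eq_inner inner_eq_Re_cinner)

instantiation complex :: complex_hilbert_space
begin

definition scaleC_complex :: "complex \<Rightarrow> complex \<Rightarrow> complex"
  where "scaleC_complex c x = c * x"

definition cinner_complex :: "complex \<Rightarrow> complex \<Rightarrow> complex"
  where "cinner_complex x y = x * cnj y"

instance
  by standard
    (simp_all add: scaleC_complex_def cinner_complex_def algebra_simps scaleR_conv_of_real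
      inner_complex_def)

end

definition bounded_clinear :: "('a::complex_inner \<Rightarrow> 'a) \<Rightarrow> bool"
  where "bounded_clinear A \<longleftrightarrow> bounded_linear A \<and> (\<forall>c x. A (c *\<^sub>C x) = c *\<^sub>C A x)"

definition invertible_op :: "('a::complex_inner \<Rightarrow> 'a) \<Rightarrow> bool"
  where "invertible_op A \<longleftrightarrow> (\<exists>B. bounded_clinear B \<and> A \<circ> B = id \<and> B \<circ> A = id)"

definition op_spectrum :: "('a::complex_inner \<Rightarrow> 'a) \<Rightarrow> complex set"
  where "op_spectrum A = {l. \<not> invertible_op (\<lambda>x. A x - l *\<^sub>C x)}"

definition numerical_range :: "('a::complex_inner \<Rightarrow> 'a) \<Rightarrow> complex set"
  where "numerical_range A = {cinner (A x) x | x. norm x = 1}"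

definition compact_op :: "('a::complex_inner \<Rightarrow> 'a) \<Rightarrow> bool"
  where "compact_op A \<longleftrightarrow>
    bounded_clinear A \<and> (\<forall>S. bounded S \<longrightarrow> compact (closure (A ` S)))"

text \<open>On a complex space, self-adjointness follows from the quadratic form being real.\<close>

definition positive_semidefinite_op :: "('a::complex_inner \<Rightarrow> 'a) \<Rightarrow> bool"
  where "positive_semidefinite_op P \<longleftrightarrow>
    bounded_clinear P \<and> (\<forall>x. cinner (P x) x \<in> \<real>\<^sub>\<ge>\<^sub>0)"

text \<open>
  The complex dimension of the range is 1; infinite-dimensional spaces are no obstacle, since
  \<open>vector_space.dim\<close> gives them the value 0.
\<close>

definition rank_one_op :: "('a::complex_inner \<Rightarrow> 'a) \<Rightarrow> bool"
  where "rank_one_op B \<longleftrightarrow> bounded_clinear B \<and> vector_space.dim scaleC (range B) = 1"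

end

theory Submission imports Defs begin

text \<open>
  (A1) implies (A2): let \<open>A = \<gamma>P\<close> with \<open>P \<ge> 0\<close>. For \<open>\<lambda> \<noteq> 0\<close> in the spectrum of \<open>AB\<close>, either
  \<open>ABx = \<lambda>x\<close> for a unit vector \<open>x\<close>, or some \<open>z \<noteq> 0\<close> is orthogonal to the range of \<open>AB - \<lambda>\<close>. With
  \<open>y = Bx\<close>, \<open>v = x\<close> in the first case and \<open>y = z\<close>, \<open>v = Pz/\<parallel>Pz\<parallel>\<close> in the second, one finds
  \<open>\<lambda> = \<gamma> (\<parallel>Py\<parallel>\<^sup>2 / \<langle>Py,y\<rangle>) \<langle>Bv,v\<rangle>\<close>, and \<open>\<parallel>Py\<parallel>\<^sup>2 / \<langle>Py,y\<rangle>\<close> lies in the numerical range of \<open>P\<close> by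
  the Cauchy-Schwarz inequality for \<open>\<langle>P\<cdot>,\<cdot>\<rangle>\<close>. If \<open>\<lambda> = 0\<close>, then \<open>0\<close> is in the spectrum of \<open>A\<close> or \<open>B\<close>,
  hence in the closure of its numerical range.

  (A3) implies (A1): suppose \<open>Re \<langle>Au,u\<rangle> \<le> h\<close> for all unit vectors \<open>u\<close>, with \<open>h > 0\<close>. Testing (A3)
  on the rank one operators \<open>(x + \<epsilon>p) \<otimes> (x + \<epsilon>q)\<close> with \<open>p, q \<bottom> x\<close>, to first order in \<open>\<epsilon>\<close>,
  shows that unit vectors that almost attain \<open>h\<close> are almost eigenvectors. So \<open>h\<close>, if it is the
  supremum, is attained, and all vectors attaining it are eigenvectors of \<open>A\<close> and of its adjoint.
  Two maximizers with different eigenvalues are therefore impossible, because their combinations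
  would be maximizers too. Applied to all multiples of \<open>A\<close>, this leaves only a segment from \<open>0\<close> for
  the numerical range.
\<close>

section \<open>Complex inner product spaces and operators\<close>

lemma cinner_add_right: "cinner x (y + z) = cinner x y + cinner x z"
  for x :: "'a::complex_inner"
  by (metis cinner_add_left cinner_commute complex_cnj_add)

lemma cinner_scaleC_right: "cinner x (c *\<^sub>C y) = cnj c * cinner x y"
  for x :: "'a::complex_inner"
  by (metis cinner_commute cinner_scaleC_left complex_cnj_mult)

lemma scaleC_one [simp]: "1 *\<^sub>C x = x"
  for x :: "'a::complex_vector"
  using scaleR_scaleC[of 1 x] by simp

lemma norm_scaleC [simp]: "norm (c *\<^sub>C x) = cmod c * norm x"
  for x :: "'a::complex_inner"
proof -
  have "complex_of_real ((norm (c *\<^sub>C x))\<^sup>2) = c * cnj c * cinner x x"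
    unfolding cinner_self[symmetric] by (simp add: cinner_scaleC_left cinner_scaleC_right)
  also have "\<dots> = complex_of_real ((cmod c * norm x)\<^sup>2)"
    by (simp only: cinner_self power_mult_distrib of_real_mult complex_norm_square)
  finally have "(norm (c *\<^sub>C x))\<^sup>2 = (cmod c * norm x)\<^sup>2"
    by (simp only: of_real_eq_iff)
  then show ?thesis
    by simp
qed

text \<open>A unimodular factor \<open>c\<close> makes the form real and nonnegative, which leaves
  the real Cauchy-Schwarz inequality.\<close>

lemma cmod_cinner_le: "cmod (cinner x y) \<le> norm x * norm y"
  for x :: "'a::complex_inner"
proof (cases "cinner x y = 0")
  case False
  define c where "c = cnj (cinner x y) / cmod (cinner x y)"
  have "cmod c = 1"
    using False by (simp add: c_def norm_divide)
  have "cinner (c *\<^sub>C x) y = cmod (cinner x y)"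
    using False complex_norm_square[of "cinner x y"]
    by (simp add: cinner_scaleC_left c_def field_simps power2_eq_square)
  then have "cmod (cinner x y) = inner (c *\<^sub>C x) y"
    by (simp add: inner_eq_Re_cinner)
  also have "\<dots> \<le> norm x * norm y"
    using norm_cauchy_schwarz[of "c *\<^sub>C x" y] \<open>cmod c = 1\<close> by simp
  finally show ?thesis .
qed simp

lemma bounded_bilinear_cinner: "bounded_bilinear (cinner :: 'a::complex_inner \<Rightarrow> 'a \<Rightarrow> complex)"
proof
  show "\<exists>K. \<forall>a b::'a. cmod (cinner a b) \<le> norm a * norm b * K"
    by (intro exI[of _ 1]) (simp add: cmod_cinner_le)
qed (simp_all add: cinner_add_left cinner_add_right scaleR_scaleC cinner_scaleC_left
      cinner_scaleC_right scaleC_complex_def)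

lemma bounded_bilinear_scaleC: "bounded_bilinear (scaleC :: complex \<Rightarrow> 'a::complex_inner \<Rightarrow> 'a)"
proof
  show "\<exists>K. \<forall>(a::complex) (b::'a). norm (a *\<^sub>C b) \<le> norm a * norm b * K"
    by (intro exI[of _ 1]) simp
qed (simp_all add: scaleC_add_left scaleC_add_right scaleR_scaleC scaleC_scaleC
      scaleC_complex_def mult.commute)

lemmas tendsto_cinner [tendsto_intros] = bounded_bilinear.tendsto[OF bounded_bilinear_cinner]
lemmas tendsto_scaleC [tendsto_intros] = bounded_bilinear.tendsto[OF bounded_bilinear_scaleC]
lemmas cinner_diff_left = bounded_bilinear.diff_left[OF bounded_bilinear_cinner]
lemmas cinner_diff_right = bounded_bilinear.diff_right[OF bounded_bilinear_cinner]
lemmas cinner_zero_left [simp] = bounded_bilinear.zero_left[OF bounded_bilinear_cinner]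
lemmas cinner_zero_right [simp] = bounded_bilinear.zero_right[OF bounded_bilinear_cinner]
lemmas scaleC_zero_left [simp] = bounded_bilinear.zero_left[OF bounded_bilinear_scaleC]
lemmas scaleC_zero_right [simp] = bounded_bilinear.zero_right[OF bounded_bilinear_scaleC]
lemmas scaleC_diff_right = bounded_bilinear.diff_right[OF bounded_bilinear_scaleC]
lemmas scaleC_minus_left = bounded_bilinear.minus_left[OF bounded_bilinear_scaleC]

lemmas cinner_simps = cinner_add_left cinner_add_right cinner_diff_left cinner_diff_right
  cinner_scaleC_left cinner_scaleC_right

lemma scaleC_eq_0_iff [simp]: "c *\<^sub>C x = 0 \<longleftrightarrow> c = 0 \<or> x = 0"
  for x :: "'a::complex_inner"
  by (metis norm_scaleC norm_eq_zero mult_eq_0_iff)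

lemma cinner_self_eq_0_iff [simp]: "cinner x x = 0 \<longleftrightarrow> x = 0"
  for x :: "'a::complex_inner"
  by (simp add: cinner_self)

lemma bounded_clinear_add: "bounded_clinear A \<Longrightarrow> A (x + y) = A x + A y"
  and bounded_clinear_diff: "bounded_clinear A \<Longrightarrow> A (x - y) = A x - A y"
  and bounded_clinear_scaleC: "bounded_clinear A \<Longrightarrow> A (c *\<^sub>C x) = c *\<^sub>C A x"
  and bounded_clinear_zero: "bounded_clinear A \<Longrightarrow> A 0 = 0"
  unfolding bounded_clinear_def
  by (auto dest: bounded_linear.linear simp: linear_add linear_diff linear_0)

lemma tendsto_bounded_clinear:
  "bounded_clinear A \<Longrightarrow> (f \<longlongrightarrow> l) F \<Longrightarrow> ((\<lambda>x. A (f x)) \<longlongrightarrow> A l) F"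
  unfolding bounded_clinear_def by (rule bounded_linear.tendsto[rotated]) simp_all

lemma bounded_clinear_bound:
  assumes "bounded_clinear A"
  obtains C where "0 \<le> C" "\<And>x. norm (A x) \<le> C * norm x"
proof -
  obtain C where "0 \<le> C" "\<forall>x. norm (A x) \<le> norm x * C"
    using assms bounded_linear.nonneg_bounded[of A] unfolding bounded_clinear_def by blast
  then show ?thesis
    using that[of C] by (simp add: mult.commute)
qed

lemma bounded_clinearI:
  assumes "\<And>x y. A (x + y) = A x + A y" "\<And>c x. A (c *\<^sub>C x) = c *\<^sub>C A x"
    and "\<And>x. norm (A x) \<le> norm x * K"
  shows "bounded_clinear A"
  unfolding bounded_clinear_def
  by (auto intro!: bounded_linear_intro[where K = K] simp: assms scaleR_scaleC)

lemma bounded_clinear_compose: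
  assumes A: "bounded_clinear A" and B: "bounded_clinear B"
  shows "bounded_clinear (A \<circ> B)"
  using assms unfolding bounded_clinear_def
  by (auto simp: o_def intro: bounded_linear_compose)

lemma bounded_clinear_scale:
  assumes A: "bounded_clinear A"
  shows "bounded_clinear (\<lambda>x. c *\<^sub>C A x)"
proof -
  obtain C where C: "0 \<le> C" "\<And>x. norm (A x) \<le> C * norm x"
    using bounded_clinear_bound[OF A] by blast
  show ?thesis
  proof (rule bounded_clinearI)
    show "norm (c *\<^sub>C A x) \<le> norm x * (cmod c * C)" for x
      using mult_left_mono[OF C(2)[of x], of "cmod c"] by (simp add: mult_ac)
  qed (simp_all add: bounded_clinear_add[OF A] bounded_clinear_scaleC[OF A] scaleC_add_right
        scaleC_scaleC mult.commute)
qed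

lemma bounded_clinear_diff_scaleC:
  assumes A: "bounded_clinear A"
  shows "bounded_clinear (\<lambda>x. A x - l *\<^sub>C x)"
proof -
  obtain C where C: "0 \<le> C" "\<And>x. norm (A x) \<le> C * norm x"
    using bounded_clinear_bound[OF A] by blast
  show ?thesis
  proof (rule bounded_clinearI)
    show "norm (A x - l *\<^sub>C x) \<le> norm x * (C + cmod l)" for x
      using norm_triangle_ineq4[of "A x" "l *\<^sub>C x"] C(2)[of x] by (simp add: algebra_simps)
  qed (simp_all add: bounded_clinear_add[OF A] bounded_clinear_scaleC[OF A] scaleC_add_right
        scaleC_scaleC mult.commute scaleC_diff_right)
qed

lemma numerical_rangeI: "norm x = 1 \<Longrightarrow> cinner (A x) x \<in> numerical_range A"
  unfolding numerical_range_def by blast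

lemma cinner_quotient_in_numerical_range:
  assumes A: "bounded_clinear A" and "x \<noteq> 0"
  shows "cinner (A x) x / (norm x)\<^sup>2 \<in> numerical_range A"
proof -
  define u where "u = complex_of_real (inverse (norm x)) *\<^sub>C x"
  have "norm u = 1"
    using \<open>x \<noteq> 0\<close> by (simp add: u_def norm_inverse del: of_real_inverse)
  moreover have "cinner (A u) u = cinner (A x) x / (norm x)\<^sup>2"
    by (simp add: u_def bounded_clinear_scaleC[OF A] cinner_simps power2_eq_square field_simps)
  ultimately show ?thesis
    using numerical_rangeI by metis
qed

section \<open>Compact operators\<close>

lemma compact_op_bounded_clinear: "compact_op A \<Longrightarrow> bounded_clinear A"
  by (simp add: compact_op_def)

lemma compact_op_subseq:
  assumes "compact_op A" "bounded (range f)"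
  obtains r :: "nat \<Rightarrow> nat" and y where "strict_mono r" "(\<lambda>n. A (f (r n))) \<longlonglongrightarrow> y"
proof -
  have "compact (closure (A ` range f))"
    using assms by (simp add: compact_op_def)
  then have sc: "seq_compact (closure (A ` range f))"
    by (rule compact_imp_seq_compact)
  have mem: "\<forall>n. A (f n) \<in> closure (A ` range f)"
    using closure_subset[of "A ` range f"] by auto
  obtain y r where "strict_mono (r :: nat \<Rightarrow> nat)" "((\<lambda>n. A (f n)) \<circ> r) \<longlonglongrightarrow> y"
    by (rule seq_compactE[OF sc mem])
  then show ?thesis
    using that by (simp add: o_def)
qed

lemma compact_op_scale:
  assumes A: "compact_op A"
  shows "compact_op (\<lambda>x. c *\<^sub>C A x)"
  unfolding compact_op_def
proof (intro conjI allI impI)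
  fix S :: "'a set" assume "bounded S"
  then have K: "compact (closure (A ` S))"
    using A by (simp add: compact_op_def)
  have "compact ((*\<^sub>C) c ` closure (A ` S))"
    by (rule compact_continuous_image[OF linear_continuous_on K])
      (rule bounded_bilinear.bounded_linear_right[OF bounded_bilinear_scaleC])
  moreover have "closure ((\<lambda>x. c *\<^sub>C A x) ` S) \<subseteq> (*\<^sub>C) c ` closure (A ` S)"
    using calculation closure_subset[of "A ` S"]
    by (intro closure_minimal) (auto simp: compact_imp_closed)
  ultimately show "compact (closure ((\<lambda>x. c *\<^sub>C A x) ` S))"
    by (metis compact_Int_closed closed_closure inf.absorb_iff2)
qed (simp add: bounded_clinear_scale compact_op_bounded_clinear A)

lemma compact_op_compose:
  assumes A: "compact_op A" and B: "bounded_clinear B"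
  shows "compact_op (A \<circ> B)"
  unfolding compact_op_def
proof (intro conjI allI impI)
  fix S :: "'a set" assume "bounded S"
  then have "bounded (B ` S)"
    using B unfolding bounded_clinear_def by (simp add: bounded_linear_image)
  then show "compact (closure ((A \<circ> B) ` S))"
    using A unfolding compact_op_def image_comp[symmetric] by blast
qed (simp add: bounded_clinear_compose compact_op_bounded_clinear A B)

text \<open>Along a subsequence \<open>A (x n)\<close> converges, and so does
  \<open>\<nu> n *\<^sub>C x n\<close>, because the difference vanishes in the limit. Since
  \<open>\<mu> \<noteq> 0\<close>, dividing by \<open>\<nu> n\<close> gives convergence of the
  vectors themselves.\<close>

lemma compact_op_approx_eigenvector:
  fixes A :: "'a::complex_inner \<Rightarrow> 'a"
  assumes A: "compact_op A" and unit: "\<And>n. norm (x n) = 1"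
    and approx: "(\<lambda>n. A (x n) - \<nu> n *\<^sub>C x n) \<longlonglongrightarrow> 0" and \<nu>: "\<nu> \<longlonglongrightarrow> \<mu>" "\<mu> \<noteq> 0"
  obtains r :: "nat \<Rightarrow> nat" and y where "strict_mono r" "(\<lambda>n. x (r n)) \<longlonglongrightarrow> y" "norm y = 1"
    "A y = \<mu> *\<^sub>C y"
proof -
  have bdd: "bounded (range x)"
    using unit by (auto simp: bounded_iff)
  then obtain r y where r: "strict_mono (r :: nat \<Rightarrow> nat)" and y: "(\<lambda>n. A (x (r n))) \<longlonglongrightarrow> y"
    using compact_op_subseq[OF A bdd] by blast
  have \<nu>r: "(\<lambda>n. \<nu> (r n)) \<longlonglongrightarrow> \<mu>" and ar: "(\<lambda>n. A (x (r n)) - \<nu> (r n) *\<^sub>C x (r n)) \<longlonglongrightarrow> 0"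
    using LIMSEQ_subseq_LIMSEQ[OF \<nu>(1) r] LIMSEQ_subseq_LIMSEQ[OF approx r]
    by (simp_all add: o_def)
  have "(\<lambda>n. A (x (r n)) - (A (x (r n)) - \<nu> (r n) *\<^sub>C x (r n))) \<longlonglongrightarrow> y - 0"
    by (intro tendsto_diff y ar)
  then have "(\<lambda>n. inverse (\<nu> (r n)) *\<^sub>C (\<nu> (r n) *\<^sub>C x (r n))) \<longlonglongrightarrow> inverse \<mu> *\<^sub>C y"
    by (intro tendsto_scaleC tendsto_inverse \<nu>r \<nu>(2)) simp
  moreover have "\<forall>\<^sub>F n in sequentially. inverse (\<nu> (r n)) *\<^sub>C (\<nu> (r n) *\<^sub>C x (r n)) = x (r n)"
    using tendsto_imp_eventually_ne[OF \<nu>r \<nu>(2)]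
    by eventually_elim (simp add: scaleC_scaleC)
  ultimately have x: "(\<lambda>n. x (r n)) \<longlonglongrightarrow> inverse \<mu> *\<^sub>C y"
    by (rule Lim_transform_eventually)
  show ?thesis
  proof
    show "norm (inverse \<mu> *\<^sub>C y) = 1"
      using tendsto_norm[OF x] by (simp only: unit LIMSEQ_const_iff)
    have "(\<lambda>n. A (x (r n))) \<longlonglongrightarrow> A (inverse \<mu> *\<^sub>C y)"
      using tendsto_bounded_clinear[OF compact_op_bounded_clinear[OF A] x] .
    then have "A (inverse \<mu> *\<^sub>C y) = y"
      using y LIMSEQ_unique by blast
    then show "A (inverse \<mu> *\<^sub>C y) = \<mu> *\<^sub>C inverse \<mu> *\<^sub>C y"
      using \<nu>(2) by (simp add: scaleC_scaleC)
  qed (fact r x)+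
qed

section \<open>The spectrum and the numerical range\<close>

text \<open>The vector \<open>z\<close> is \<open>v\<close> minus its best approximation in
  \<open>M\<close>. A minimizing sequence is Cauchy by the parallelogram law, and completeness
  supplies its limit.\<close>

lemma closed_subspace_orthogonal:
  fixes M :: "'a::{real_inner, complete_space} set"
  assumes M: "subspace M" "closed M" and v: "v \<notin> M"
  obtains z where "z \<noteq> 0" "\<And>m. m \<in> M \<Longrightarrow> inner m z = 0"
proof -
  define d where "d = (INF m\<in>M. (norm (v - m))\<^sup>2)"
  have ne: "M \<noteq> {}"
    using M(1) subspace_0 by blast
  have lower: "d \<le> (norm (v - m))\<^sup>2" if "m \<in> M" for m
    unfolding d_def by (rule cINF_lower[OF _ that]) (auto intro: bdd_belowI2[where m = 0])
  have "\<exists>m\<in>M. (norm (v - m))\<^sup>2 < d + inverse (Suc n)" for n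
    using cInf_lessD[of "(\<lambda>m. (norm (v - m))\<^sup>2) ` M" "d + inverse (Suc n)"] ne
    unfolding d_def by (auto simp del: of_nat_Suc)
  then obtain m where m: "m n \<in> M" "(norm (v - m n))\<^sup>2 < d + inverse (Suc n)" for n
    by metis
  \<comment> \<open>The midpoint of \<open>m i\<close> and \<open>m j\<close> is in
    \<open>M\<close>, so its squared distance from \<open>v\<close> is at least \<open>d\<close>;
    the parallelogram law turns this into a bound on the gap.\<close>
  have gap: "(norm (m i - m j))\<^sup>2 \<le> 2 * inverse (Suc i) + 2 * inverse (Suc j)" for i j
  proof -
    have "(1/2) *\<^sub>R (m i + m j) \<in> M"
      by (intro subspace_mul subspace_add M m)
    then have "4 * d \<le> 4 * (norm (v - (1/2) *\<^sub>R (m i + m j)))\<^sup>2"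
      using lower by simp
    also have "\<dots> = (norm ((v - m i) + (v - m j)))\<^sup>2"
      by (simp add: power2_norm_eq_inner inner_simps algebra_simps)
    also have "\<dots> = 2 * (norm (v - m i))\<^sup>2 + 2 * (norm (v - m j))\<^sup>2 - (norm (m i - m j))\<^sup>2"
      by (simp add: power2_norm_eq_inner inner_simps inner_commute)
    finally show ?thesis
      using m(2)[of i] m(2)[of j] by linarith
  qed
  have "Cauchy m"
  proof (rule metric_CauchyI)
    fix e :: real assume "0 < e"
    then obtain N where N: "inverse (Suc N) < e\<^sup>2 / 4"
      using reals_Archimedean[of "e\<^sup>2 / 4"] by auto
    have "dist (m i) (m j) < e" if "N \<le> i" "N \<le> j" for i j
    proof -
      have "inverse (real (Suc i)) \<le> inverse (Suc N)" "inverse (real (Suc j)) \<le> inverse (Suc N)"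
        using that by (auto intro!: le_imp_inverse_le simp del: of_nat_Suc)
      then have "(norm (m i - m j))\<^sup>2 < e\<^sup>2"
        using gap[of i j] N by linarith
      then show ?thesis
        using \<open>0 < e\<close> power2_less_imp_less by (fastforce simp: dist_norm)
    qed
    then show "\<exists>N. \<forall>i\<ge>N. \<forall>j\<ge>N. dist (m i) (m j) < e"
      by blast
  qed
  then obtain l where l: "m \<longlonglongrightarrow> l"
    by (meson Cauchy_convergent convergent_def)
  have "l \<in> M"
    using closed_sequentially[OF M(2) _ l] m(1) by blast
  have "(norm (v - l))\<^sup>2 \<le> d + 0"
  proof (rule LIMSEQ_le)
    show "(\<lambda>n. (norm (v - m n))\<^sup>2) \<longlonglongrightarrow> (norm (v - l))\<^sup>2"
      by (intro tendsto_power tendsto_norm tendsto_diff tendsto_const l)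
    show "(\<lambda>n. d + inverse (Suc n)) \<longlonglongrightarrow> d + 0"
      by (intro tendsto_add tendsto_const LIMSEQ_inverse_real_of_nat)
  qed (use m(2) less_imp_le in blast)
  then have dl: "(norm (v - l))\<^sup>2 \<le> d"
    by simp
  show ?thesis
  proof
    show "v - l \<noteq> 0"
      using v \<open>l \<in> M\<close> by auto
    fix u assume "u \<in> M"
    show "inner u (v - l) = 0"
    proof (cases "u = 0")
      case False
      \<comment> \<open>This \<open>t\<close> minimizes the distance from \<open>v - l\<close> to
        the line spanned by \<open>u\<close>; the gain \<open>a\<^sup>2 / inner u u\<close> must
        vanish, as \<open>l\<close> is already optimal.\<close>
      define a t where "a = inner u (v - l)" and "t = a / inner u u"
      have "l + t *\<^sub>R u \<in> M"
        by (intro subspace_mul subspace_add M \<open>l \<in> M\<close> \<open>u \<in> M\<close>)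
      then have "(norm (v - l))\<^sup>2 \<le> (norm ((v - l) - t *\<^sub>R u))\<^sup>2"
        using dl lower[of "l + t *\<^sub>R u"] unfolding diff_diff_eq by linarith
      also have "\<dots> = (norm (v - l))\<^sup>2 - 2 * t * a + t\<^sup>2 * inner u u"
        unfolding a_def power2_norm_eq_inner
        by (simp add: inner_simps inner_commute power2_eq_square algebra_simps)
      also have "\<dots> = (norm (v - l))\<^sup>2 - a\<^sup>2 / inner u u"
        using False by (simp add: t_def power2_eq_square field_simps)
      finally have "a\<^sup>2 \<le> 0"
        using False by (simp add: divide_le_0_iff flip: power2_norm_eq_inner)
      then show ?thesis
        by (simp add: a_def)
    qed simp
  qed
qed

text \<open>If \<open>T\<close> is not bounded below on the unit sphere, \<open>approx\<close>
  holds. Otherwise \<open>T\<close> is injective with closed range and a bounded inverse on it, so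
  only a proper range can prevent invertibility, and a vector orthogonal to the range
  exists.\<close>

lemma not_invertible_op_cases:
  fixes T :: "'a::complex_hilbert_space \<Rightarrow> 'a"
  assumes T: "bounded_clinear T" and ninv: "\<not> invertible_op T"
  obtains (approx) x where "\<And>n::nat. norm (x n) = 1" "(\<lambda>n. T (x n)) \<longlonglongrightarrow> 0"
  | (orth) z where "z \<noteq> 0" "\<And>x. cinner (T x) z = 0"
proof (cases "\<exists>e>0. \<forall>x. norm x = 1 \<longrightarrow> e \<le> norm (T x)")
  case False
  have "\<exists>x. norm x = 1 \<and> norm (T x) < inverse (Suc n)" for n
    using False[simplified, rule_format, of "inverse (Suc n)"] by (auto simp: not_le)
  then obtain x where x: "norm (x n) = 1" "norm (T (x n)) < inverse (Suc n)" for n :: nat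
    by metis
  have "(\<lambda>n. T (x n)) \<longlonglongrightarrow> 0"
    by (intro Lim_null_comparison[OF always_eventually LIMSEQ_inverse_real_of_nat] allI
        less_imp_le x(2))
  then show thesis
    using approx x(1) by blast
next
  case True
  then obtain e where e: "0 < e" "\<And>x. norm x = 1 \<Longrightarrow> e \<le> norm (T x)"
    by blast
  have bl: "bounded_linear T"
    using T by (simp add: bounded_clinear_def)
  have below: "e * norm x \<le> norm (T x)" for x
  proof (cases "x = 0")
    case False
    then have "e \<le> norm (T ((1 / norm x) *\<^sub>R x))"
      by (intro e) simp
    also have "T ((1 / norm x) *\<^sub>R x) = (1 / norm x) *\<^sub>R T x"
      using bl by (simp add: linear_simps)
    finally show ?thesis
      using False by (simp add: field_simps)
  qed simp
  have "inj T"
  proof (rule injI)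
    fix x y assume "T x = T y"
    then show "x = y"
      using below[of "x - y"] e(1) by (simp add: bounded_clinear_diff[OF T] mult_le_0_iff)
  qed
  have "range T \<noteq> UNIV"
  proof
    assume surj: "range T = UNIV"
    have TI: "T (inv T y) = y" for y
      using surj surj_f_inv_f by metis
    have IT: "inv T (T x) = x" for x
      using \<open>inj T\<close> by simp
    have "bounded_clinear (inv T)"
    proof (rule bounded_clinearI)
      fix x y c
      show "inv T (x + y) = inv T x + inv T y"
        using IT[of "inv T x + inv T y"] by (simp only: bounded_clinear_add[OF T] TI)
      show "inv T (c *\<^sub>C x) = c *\<^sub>C inv T x"
        using IT[of "c *\<^sub>C inv T x"] by (simp only: bounded_clinear_scaleC[OF T] TI)
      show "norm (inv T x) \<le> norm x * (1 / e)"
        using below[of "inv T x"] e(1) by (simp add: TI field_simps)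
    qed
    then have "invertible_op T"
      unfolding invertible_op_def by (intro exI[of _ "inv T"]) (auto simp: TI IT)
    then show False
      using ninv by simp
  qed
  then obtain v where v: "v \<notin> range T"
    by blast
  have "complete (range T)"
    by (rule complete_isometric_image[OF e(1) subspace_UNIV bl]) (auto simp: below complete_UNIV)
  then have "closed (range T)" and "subspace (range T)"
    using bl by (auto simp: complete_imp_closed bounded_linear.linear intro!: linear_subspace_image)
  from closed_subspace_orthogonal[OF this(2,1) v] obtain z
    where z: "z \<noteq> 0" "\<And>m. m \<in> range T \<Longrightarrow> inner m z = 0"
    by blast
  \<comment> \<open>Real orthogonality controls only the real part; testing it on
    \<open>\<i> *\<^sub>C x\<close> as well controls the imaginary part.\<close>
  have "cinner (T x) z = 0" for x
  proof (rule complex_eqI)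
    show "Re (cinner (T x) z) = Re 0"
      using z(2)[of "T x"] by (simp add: inner_eq_Re_cinner)
    have "Re (cinner (T (\<i> *\<^sub>C x)) z) = 0"
      using z(2)[of "T (\<i> *\<^sub>C x)"] by (simp add: inner_eq_Re_cinner)
    then show "Im (cinner (T x) z) = Im 0"
      by (simp add: bounded_clinear_scaleC[OF T] cinner_scaleC_left)
  qed
  then show thesis
    using orth z(1) by blast
qed

lemma zero_in_closure_numerical_range:
  fixes T :: "'a::complex_hilbert_space \<Rightarrow> 'a"
  assumes T: "bounded_clinear T" and "\<not> invertible_op T"
  shows "0 \<in> closure (numerical_range T)"
  using assms
proof (cases rule: not_invertible_op_cases)
  case (approx x)
  have "(\<lambda>n. cinner (T (x n)) (x n)) \<longlonglongrightarrow> 0"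
  proof (rule Lim_null_comparison)
    show "\<forall>\<^sub>F n in sequentially. cmod (cinner (T (x n)) (x n)) \<le> norm (T (x n))"
      using cmod_cinner_le[of "T (x n)" "x n" for n] by (simp add: approx(1))
    show "(\<lambda>n. norm (T (x n))) \<longlonglongrightarrow> 0"
      using tendsto_norm[OF approx(2)] by simp
  qed
  then show ?thesis
    unfolding closure_sequential
    by (intro exI[of _ "\<lambda>n. cinner (T (x n)) (x n)"]) (simp add: numerical_rangeI approx(1))
next
  case (orth z)
  then show ?thesis
    using cinner_quotient_in_numerical_range[OF T orth(1)] closure_subset by fastforce
qed

lemma invertible_op_compose:
  assumes "invertible_op A" "invertible_op B"
  shows "invertible_op (A \<circ> B)"
proof -
  obtain A' B' where "bounded_clinear A'" "A \<circ> A' = id" "A' \<circ> A = id"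
    and "bounded_clinear B'" "B \<circ> B' = id" "B' \<circ> B = id"
    using assms unfolding invertible_op_def by auto
  then show ?thesis
    unfolding invertible_op_def
    by (intro exI[of _ "B' \<circ> A'"]) (auto simp: bounded_clinear_compose fun_eq_iff)
qed

section \<open>Positive semidefinite operators\<close>

lemma positive_semidefinite_op_clinear: "positive_semidefinite_op P \<Longrightarrow> bounded_clinear P"
  by (simp add: positive_semidefinite_op_def)

lemma positive_semidefinite_op_quadratic:
  assumes "positive_semidefinite_op P"
  shows "Im (cinner (P x) x) = 0" "0 \<le> Re (cinner (P x) x)"
  using assms by (auto simp: positive_semidefinite_op_def complex_nonneg_Reals_iff)

text \<open>Polarization: the quadratic form is real at \<open>x + y\<close> and at
  \<open>x + \<i> *\<^sub>C y\<close>, which fixes the imaginary and real parts of the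
  claim.\<close>

lemma positive_semidefinite_op_commute:
  assumes P: "positive_semidefinite_op P"
  shows "cinner (P x) y = cinner x (P y)"
proof -
  note lin = bounded_clinear_add[OF positive_semidefinite_op_clinear[OF P]]
    bounded_clinear_scaleC[OF positive_semidefinite_op_clinear[OF P]]
  have "Im (cinner (P (x + y)) (x + y)) = 0" "Im (cinner (P (x + \<i> *\<^sub>C y)) (x + \<i> *\<^sub>C y)) = 0"
    by (rule positive_semidefinite_op_quadratic[OF P])+
  then have "cinner (P x) y = cnj (cinner (P y) x)"
    by (simp add: lin cinner_simps positive_semidefinite_op_quadratic[OF P] complex_eq_iff)
  then show ?thesis
    using cinner_commute[of x "P y"] by simp
qed

text \<open>The intermediate value theorem is applied to the Rayleigh quotient along the segment
  from \<open>x\<close> to \<open>y\<close>. The segment meets \<open>0\<close> only if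
  \<open>y = - x\<close>, and then both ends give the same value.\<close>

lemma numerical_range_between:
  assumes P: "positive_semidefinite_op P"
    and x: "norm x = 1" "Re (cinner (P x) x) \<le> s" and y: "norm y = 1" "s \<le> Re (cinner (P y) y)"
  shows "complex_of_real s \<in> numerical_range P"
proof -
  note cl = positive_semidefinite_op_clinear[OF P]
  define q where "q v = Re (cinner (P v) v)" for v
  have q: "cinner (P v) v = q v" for v
    by (simp add: q_def complex_eq_iff positive_semidefinite_op_quadratic[OF P])
  have scale: "q (c *\<^sub>C v) = (cmod c)\<^sup>2 * q v" for c v
    unfolding cmod_power2
    by (simp add: q_def bounded_clinear_scaleC[OF cl] cinner_simps power2_eq_square algebra_simps)
  show ?thesis
  proof (cases "x + y = 0")
    case True
    then have "y = (-1) *\<^sub>C x"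
      by (simp add: scaleC_minus_left eq_neg_iff_add_eq_0 add.commute)
    then have "s = q x"
      using x(2) y(2) scale[of "-1" x] by (simp add: q_def)
    then show ?thesis
      using numerical_rangeI[OF x(1), of P] by (simp add: q)
  next
    case False
    define g where "g t = (1 - t) *\<^sub>R x + t *\<^sub>R y" for t :: real
    define f where "f t = q (g t) / (norm (g t))\<^sup>2" for t
    have g0: "g t \<noteq> 0" for t
    proof
      assume "g t = 0"
      then have eq: "(1 - t) *\<^sub>R x = (- t) *\<^sub>R y"
        by (simp add: g_def eq_neg_iff_add_eq_0)
      have "\<bar>1 - t\<bar> = \<bar>t\<bar>"
        using arg_cong[OF eq, of norm]
        by (simp only: norm_scaleR x(1) y(1) abs_minus_cancel mult_1_right)
      then have "t = 1 / 2"
        by linarith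
      have "g t = (1 / 2) *\<^sub>R (x + y)"
        unfolding g_def \<open>t = 1 / 2\<close> by (simp add: scaleR_add_right)
      then show False
        using \<open>g t = 0\<close> False by simp
    qed
    have "continuous_on {0..1} g"
      unfolding g_def by (intro continuous_intros)
    moreover have "continuous_on {0..1} (\<lambda>t. P (g t))"
      using cl calculation unfolding bounded_clinear_def
      by (intro bounded_linear.continuous_on[of P]) auto
    ultimately have "continuous_on {0..1} f"
      unfolding f_def q_def using g0
      by (intro continuous_intros bounded_bilinear.continuous_on[OF bounded_bilinear_cinner]) auto
    moreover have "f 0 \<le> s" "s \<le> f 1"
      using x y by (simp_all add: f_def g_def q_def)
    ultimately obtain t where "f t = s"
      using IVT'[of f 0 s 1] by auto
    then show ?thesis
      using cinner_quotient_in_numerical_range[OF cl g0[of t]] unfolding q f_def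
      by (metis of_real_divide of_real_power)
  qed
qed

text \<open>The quotient lies between the Rayleigh quotients of \<open>z\<close> and of
  \<open>P z\<close>: in the notation of the proof,
  \<open>t / (norm z)\<^sup>2 \<le> n / t \<le> k / n\<close>. The first inequality is
  Cauchy-Schwarz for the inner product, the second is Cauchy-Schwarz for the form of
  \<open>P\<close>.\<close>

lemma image_quotient_in_numerical_range:
  assumes P: "positive_semidefinite_op P" and z: "P z \<noteq> 0"
  shows "0 < Re (cinner (P z) z)"
    and "complex_of_real ((norm (P z))\<^sup>2 / Re (cinner (P z) z)) \<in> numerical_range P"
proof -
  note cl = positive_semidefinite_op_clinear[OF P]
  define t n k where "t = Re (cinner (P z) z)" and "n = (norm (P z))\<^sup>2"
    and "k = Re (cinner (P (P z)) (P z))"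
  have "0 < n"
    using z by (simp add: n_def)
  have form: "0 \<le> t - 2 * s * n + s\<^sup>2 * k" for s
  proof -
    have "0 \<le> Re (cinner (P (z - of_real s *\<^sub>C P z)) (z - of_real s *\<^sub>C P z))"
      by (rule positive_semidefinite_op_quadratic[OF P])
    also have "\<dots> = t - 2 * s * n + s\<^sup>2 * k"
      using cinner_self[of "P z"]
      by (simp add: t_def n_def k_def bounded_clinear_diff[OF cl] bounded_clinear_scaleC[OF cl]
          cinner_simps positive_semidefinite_op_commute[OF P, of "P z" z] power2_eq_square
          algebra_simps)
    finally show ?thesis .
  qed
  have "0 \<le> t" "0 \<le> k"
    unfolding t_def k_def by (rule positive_semidefinite_op_quadratic[OF P])+
  have "0 < k"
  proof (rule ccontr)
    assume "\<not> 0 < k"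
    then have "0 \<le> t - (t + 1)"
      \<comment> \<open>For \<open>k = 0\<close> the polynomial in \<open>s\<close> is affine, and
        this choice gives it the value \<open>-1\<close>.\<close>
      using form[of "(t + 1) / (2 * n)"] \<open>0 \<le> k\<close> \<open>0 < n\<close> by simp
    then show False by simp
  qed
  have "n\<^sup>2 \<le> t * k"
    \<comment> \<open>The choice \<open>s = n / k\<close> minimizes the polynomial.\<close>
    using form[of "n / k"] \<open>0 < k\<close> by (simp add: field_simps power2_eq_square)
  then show "0 < t"
    using \<open>0 < n\<close> \<open>0 \<le> t\<close> by (cases "t = 0") auto
  have "z \<noteq> 0"
    using z bounded_clinear_zero[OF cl] by auto
  have unit: "norm ((1 / norm v) *\<^sub>R v) = 1"
    "Re (cinner (P ((1 / norm v) *\<^sub>R v)) ((1 / norm v) *\<^sub>R v)) = Re (cinner (P v) v) / (norm v)\<^sup>2"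
    if "v \<noteq> 0" for v :: 'a
    using that by (simp, simp add: scaleR_scaleC bounded_clinear_scaleC[OF cl] cinner_simps
        power2_eq_square)
  show "complex_of_real (n / t) \<in> numerical_range P"
  proof (rule numerical_range_between[OF P unit(1)[OF \<open>z \<noteq> 0\<close>] _ unit(1)[OF z]])
    have "t \<le> norm (P z) * norm z"
      using cmod_cinner_le[of "P z" z] complex_Re_le_cmod[of "cinner (P z) z"] unfolding t_def
      by linarith
    then have "t\<^sup>2 \<le> n * (norm z)\<^sup>2"
      unfolding n_def power_mult_distrib[symmetric] using \<open>0 \<le> t\<close> by (rule power_mono)
    then show "Re (cinner (P ((1 / norm z) *\<^sub>R z)) ((1 / norm z) *\<^sub>R z)) \<le> n / t"
      using \<open>z \<noteq> 0\<close> \<open>0 < t\<close> unfolding unit(2)[OF \<open>z \<noteq> 0\<close>] t_def[symmetric]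
      by (simp add: field_simps power2_eq_square)
    show "n / t \<le> Re (cinner (P ((1 / norm (P z)) *\<^sub>R P z)) ((1 / norm (P z)) *\<^sub>R P z))"
      using \<open>n\<^sup>2 \<le> t * k\<close> \<open>0 < t\<close> \<open>0 < n\<close>
      unfolding unit(2)[OF z] k_def[symmetric] n_def[symmetric]
      by (simp add: field_simps power2_eq_square)
  qed
qed

section \<open>Spectral inclusion for multiples of positive operators\<close>

lemma times_closure_subset: "closure S * closure T \<subseteq> closure (S * T)"
  for S T :: "complex set"
proof
  fix z assume "z \<in> closure S * closure T"
  then obtain a b f g where z: "z = a * b" and f: "\<forall>n::nat. f n \<in> S" "f \<longlonglongrightarrow> a"
    and g: "\<forall>n::nat. g n \<in> T" "g \<longlonglongrightarrow> b"
    unfolding set_times_def mem_Collect_eq Bex_def closure_sequential by blast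
  then show "z \<in> closure (S * T)"
    unfolding closure_sequential z
    by (intro exI[of _ "\<lambda>n. f n * g n"]) (simp add: set_times_intro tendsto_mult f g)
qed

lemma op_spectrum_compose_subset:
  fixes P B :: "'a::complex_hilbert_space \<Rightarrow> 'a"
  assumes P: "positive_semidefinite_op P" and A: "compact_op A" "A = (\<lambda>x. \<gamma> *\<^sub>C P x)"
    and B: "bounded_clinear B"
  shows "op_spectrum (A \<circ> B) \<subseteq> closure (numerical_range A * numerical_range B)"
proof
  fix l assume "l \<in> op_spectrum (A \<circ> B)"
  then have ninv: "\<not> invertible_op (\<lambda>x. (A \<circ> B) x - l *\<^sub>C x)"
    by (simp add: op_spectrum_def)
  note clP = positive_semidefinite_op_clinear[OF P] and clA = compact_op_bounded_clinear[OF A(1)]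
  note clAB = bounded_clinear_compose[OF clA B]
  let ?W = "numerical_range A * numerical_range B"
  show "l \<in> closure ?W"
  proof (cases "l = 0")
    case True
    have "\<not> invertible_op A \<or> \<not> invertible_op B"
      using ninv invertible_op_compose[of A B] by (auto simp: True o_def)
    then have "0 \<in> closure (numerical_range A) \<or> 0 \<in> closure (numerical_range B)"
      using zero_in_closure_numerical_range clA B by blast
    \<comment> \<open>A numerical range with \<open>0\<close> in its closure is nonempty, so a unit
      vector exists and the other numerical range is nonempty too.\<close>
    moreover have "closure (numerical_range A) \<noteq> {}" "closure (numerical_range B) \<noteq> {}"
      using calculation by (auto simp: numerical_range_def intro: ccontr)
    ultimately obtain a b where ab: "a \<in> closure (numerical_range A)" "b \<in> closure (numerical_range B)"
      "a * b = 0"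
      by (metis ex_in_conv mult_zero_left mult_zero_right)
    then have "a * b \<in> closure ?W"
      using times_closure_subset[of "numerical_range A" "numerical_range B"] by blast
    then show ?thesis
      by (simp add: True ab(3))
  next
    case False
    have key: "l \<in> ?W" if "P y \<noteq> 0" "b \<in> numerical_range B"
      "l = \<gamma> * ((norm (P y))\<^sup>2 / Re (cinner (P y) y)) * b" for y b
    proof -
      have "\<gamma> * ((norm (P y))\<^sup>2 / Re (cinner (P y) y)) \<in> numerical_range A"
        using image_quotient_in_numerical_range(2)[OF P that(1)]
        unfolding numerical_range_def A(2) mem_Collect_eq cinner_scaleC_left by metis
      then show ?thesis
        unfolding that(3) using that(2) by (rule set_times_intro)
    qed
    have "l \<in> ?W"
      using bounded_clinear_diff_scaleC[OF clAB] ninv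
    proof (cases rule: not_invertible_op_cases)
      case (approx f)
      obtain x where x: "norm x = 1" "(A \<circ> B) x = l *\<^sub>C x"
        using compact_op_approx_eigenvector[OF compact_op_compose[OF A(1) B] approx(1,2)
            tendsto_const False] .
      define t where "t = Re (cinner (P (B x)) (B x))"
      have eig: "\<gamma> *\<^sub>C P (B x) = l *\<^sub>C x"
        using x(2) by (simp add: A(2))
      then have "\<gamma> \<noteq> 0" and nz: "P (B x) \<noteq> 0"
        using False x(1) by force+
      have "0 < t"
        using image_quotient_in_numerical_range(1)[OF P nz] by (simp add: t_def)
      have "\<gamma> * cinner (P (B x)) (B x) = l * cinner x (B x)"
        using arg_cong[OF eig, of "\<lambda>v. cinner v (B x)"] by (simp add: cinner_simps)
      moreover have "cinner (P (B x)) (B x) = t"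
        by (simp add: t_def complex_eq_iff positive_semidefinite_op_quadratic[OF P])
      ultimately have "cinner x (B x) = \<gamma> * t / l"
        using False by simp
      then have b: "cinner (B x) x = cnj (\<gamma> * t / l)"
        using cinner_commute[of "B x" x] by simp
      have "cmod \<gamma> * norm (P (B x)) = cmod l"
        using arg_cong[OF eig, of norm] x(1) by simp
      then have n: "complex_of_real ((norm (P (B x)))\<^sup>2) * (\<gamma> * cnj \<gamma>) = l * cnj l"
        unfolding complex_norm_square[symmetric] of_real_mult[symmetric] of_real_eq_iff
        \<comment> \<open>Taking norms in \<open>eig\<close> gives this identity; it is what cancels
          the conjugate that enters when \<open>cinner x (B x)\<close> is turned into
          \<open>cinner (B x) x\<close>.\<close>
        by (metis mult.commute power_mult_distrib)
      show ?thesis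
      proof (rule key[OF nz numerical_rangeI[OF x(1)]])
        have "\<gamma> * ((norm (P (B x)))\<^sup>2 / t) * cnj (\<gamma> * t / l) =
            (complex_of_real ((norm (P (B x)))\<^sup>2) * (\<gamma> * cnj \<gamma>)) / cnj l"
          using \<open>0 < t\<close> by simp
        also have "\<dots> = l"
          unfolding n using False by simp
        finally show "l = \<gamma> * ((norm (P (B x)))\<^sup>2 / Re (cinner (P (B x)) (B x))) * cinner (B x) x"
          unfolding b t_def[symmetric] by simp
      qed
    next
      case (orth z)
      define t where "t = Re (cinner (P z) z)"
      \<comment> \<open>Moving \<open>P\<close> to the second argument makes both uses immediate:
        \<open>v = z\<close> shows \<open>P z \<noteq> 0\<close>, and \<open>v = P z\<close>
        expresses \<open>l\<close> through the form of \<open>B\<close> at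
        \<open>P z\<close>.\<close>
      have orthP: "\<gamma> * cinner (B v) (P z) = l * cinner v z" for v
        using orth(2)[of v] positive_semidefinite_op_commute[OF P, of "B v" z]
        by (simp add: A(2) cinner_simps)
      have nz: "P z \<noteq> 0"
        using orthP[of z] False orth(1) by auto
      have "0 < t"
        using image_quotient_in_numerical_range(1)[OF P nz] by (simp add: t_def)
      have "cinner (P z) z = t"
        by (simp add: t_def complex_eq_iff positive_semidefinite_op_quadratic[OF P])
      then have "\<gamma> * cinner (B (P z)) (P z) = l * t"
        using orthP[of "P z"] by simp
      then show ?thesis
        using \<open>0 < t\<close> nz
        by (intro key[OF nz cinner_quotient_in_numerical_range[OF B nz]])
          (simp add: t_def[symmetric])
    qed
    then show ?thesis
      using closure_subset by blast
  qed
qed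

section \<open>Operators satisfying the rank one inclusion\<close>

text \<open>This is the inclusion for \<open>B z = cinner z y *\<^sub>C x\<close>, tested at the
  eigenvalue \<open>cinner (A x) y\<close> of \<open>A \<circ> B\<close> against half-planes
  \<open>Re c \<le> M\<close>. The condition \<open>0 \<le> M\<close> covers the degenerate case
  \<open>A x = 0\<close> or \<open>y = 0\<close>.\<close>

definition rank_one_dominated :: "('a::complex_inner \<Rightarrow> 'a) \<Rightarrow> bool"
  where "rank_one_dominated A \<longleftrightarrow> (\<forall>x y M. 0 \<le> M \<longrightarrow>
    (\<forall>u z. norm u = 1 \<longrightarrow> norm z = 1 \<longrightarrow> Re (cinner (A u) u * (cinner z y * cinner x z)) \<le> M) \<longrightarrow>
    Re (cinner (A x) y) \<le> M)"

lemma rank_one_dominatedD: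
  assumes "rank_one_dominated A" "0 \<le> M"
    and "\<And>u z. norm u = 1 \<Longrightarrow> norm z = 1 \<Longrightarrow> Re (cinner (A u) u * (cinner z y * cinner x z)) \<le> M"
  shows "Re (cinner (A x) y) \<le> M"
  using assms unfolding rank_one_dominated_def by blast

text \<open>The scalar is absorbed into \<open>y\<close>. Every supporting direction of the
  numerical range can thus be treated as the real direction.\<close>

lemma rank_one_dominated_scale:
  fixes A :: "'a::complex_inner \<Rightarrow> 'a"
  assumes A: "rank_one_dominated A"
  shows "rank_one_dominated (\<lambda>x. c *\<^sub>C A x)"
  unfolding rank_one_dominated_def
proof (intro allI impI)
  fix x y :: 'a and M
  assume M: "0 \<le> M" and *: "\<forall>u z. norm u = 1 \<longrightarrow> norm z = 1 \<longrightarrow>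
    Re (cinner (c *\<^sub>C A u) u * (cinner z y * cinner x z)) \<le> M"
  have "Re (cinner (A x) (cnj c *\<^sub>C y)) \<le> M"
    by (rule rank_one_dominatedD[OF A M]) (use * in \<open>simp add: cinner_simps mult_ac\<close>)
  then show "Re (cinner (c *\<^sub>C A x) y) \<le> M"
    by (simp add: cinner_simps)
qed

text \<open>When \<open>A x\<close> and \<open>y\<close> are nonzero, \<open>A x\<close> is an
  eigenvector of \<open>A \<circ> B\<close> with eigenvalue \<open>cinner (A x) y\<close>, which
  puts this number into the spectrum.\<close>

lemma rank_one_dominatedI:
  fixes A :: "'a::complex_inner \<Rightarrow> 'a"
  assumes A: "bounded_clinear A"
    and incl: "\<And>B. rank_one_op B \<Longrightarrow>
      op_spectrum (A \<circ> B) \<subseteq> closure (numerical_range A * numerical_range B)"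
  shows "rank_one_dominated A"
  unfolding rank_one_dominated_def
proof (intro allI impI)
  fix x y :: 'a and M
  assume M: "0 \<le> M" and bound: "\<forall>u z. norm u = 1 \<longrightarrow> norm z = 1 \<longrightarrow>
    Re (cinner (A u) u * (cinner z y * cinner x z)) \<le> M"
  show "Re (cinner (A x) y) \<le> M"
  proof (cases "A x = 0 \<or> y = 0")
    case True
    then show ?thesis
      using M by auto
  next
    case False
    then have nz: "A x \<noteq> 0" "y \<noteq> 0" "x \<noteq> 0"
      using bounded_clinear_zero[OF A] by auto
    define B where "B z = cinner z y *\<^sub>C x" for z
    interpret cv: vector_space "scaleC :: complex \<Rightarrow> 'a \<Rightarrow> 'a"
      by (rule vector_space_scaleC)
    have "range B = cv.span {x}"
    proof -
      have "c *\<^sub>C x \<in> range B" for c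
        by (rule range_eqI[of _ _ "(c / cinner y y) *\<^sub>C y"])
          (use nz in \<open>simp add: B_def cinner_simps\<close>)
      then show ?thesis
        by (auto simp: cv.span_singleton B_def)
    qed
    then have "cv.dim (range B) = 1"
      using nz by (simp add: cv.dim_eq_card_independent)
    moreover have "bounded_clinear B"
    proof (rule bounded_clinearI)
      show "norm (B z) \<le> norm z * (norm y * norm x)" for z
        using mult_right_mono[OF cmod_cinner_le[of z y] norm_ge_zero[of x]]
        by (simp add: B_def mult_ac)
    qed (simp_all add: B_def cinner_simps scaleC_add_left scaleC_scaleC)
    ultimately have "rank_one_op B"
      by (simp add: rank_one_op_def)
    have "cinner (A x) y \<in> op_spectrum (A \<circ> B)"
    proof -
      have "\<not> invertible_op (\<lambda>z. (A \<circ> B) z - cinner (A x) y *\<^sub>C z)"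
      proof
        assume "invertible_op (\<lambda>z. (A \<circ> B) z - cinner (A x) y *\<^sub>C z)"
        then obtain C where "bounded_clinear C"
          and C: "C \<circ> (\<lambda>z. (A \<circ> B) z - cinner (A x) y *\<^sub>C z) = id"
          unfolding invertible_op_def by blast
        have "A x = C ((A \<circ> B) (A x) - cinner (A x) y *\<^sub>C A x)"
          using fun_cong[OF C, of "A x"] by simp
        also have "\<dots> = 0"
          by (simp add: B_def bounded_clinear_scaleC[OF A] bounded_clinear_zero[OF \<open>bounded_clinear C\<close>])
        finally show False
          using nz by simp
      qed
      then show ?thesis
        by (simp add: op_spectrum_def)
    qed
    also have "\<dots> \<subseteq> closure (numerical_range A * numerical_range B)"
      by (rule incl) fact
    also have "\<dots> \<subseteq> {c. Re c \<le> M}"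
    proof (rule closure_minimal)
      show "numerical_range A * numerical_range B \<subseteq> {c. Re c \<le> M}"
        using bound by (auto simp: set_times_def numerical_range_def B_def cinner_simps)
    qed (rule closed_halfspace_Re_le)
    finally show ?thesis
      by simp
  qed
qed

section \<open>Maximizers of the real part of the quadratic form\<close>

text \<open>Perturbing \<open>x\<close> to \<open>X\<close> and \<open>Y\<close> changes
  \<open>cinner (A x) x\<close> to first order by \<open>e\<close> times the quantity to be bounded,
  whereas the dominating products exceed \<open>h\<close> only by a multiple of
  \<open>e\<^sup>2\<close>. The constant depends on \<open>h\<close> and the norm bound alone, hence
  is uniform in \<open>x\<close>.\<close>

lemma near_maximizer_estimate:
  fixes A :: "'a::complex_inner \<Rightarrow> 'a"
  assumes A: "bounded_clinear A" "rank_one_dominated A" and h: "0 < h"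
    and max: "\<And>u. norm u = 1 \<Longrightarrow> Re (cinner (A u) u) \<le> h"
  obtains K where "\<And>x p q e. \<lbrakk>norm x = 1; cinner p x = 0; cinner q x = 0; norm p \<le> 1; norm q \<le> 1;
    0 < e; h - e\<^sup>2 \<le> Re (cinner (A x) x)\<rbrakk> \<Longrightarrow> Re (cinner (A p) x + cinner (A x) q) \<le> K * e"
proof -
  obtain C where C: "0 \<le> C" "\<And>x. norm (A x) \<le> C * norm x"
    using bounded_clinear_bound[OF A(1)] by blast
  have CA: "cmod (cinner (A u) v) \<le> C" if "norm u \<le> 1" "norm v \<le> 1" for u v
  proof -
    have "cmod (cinner (A u) v) \<le> norm (A u) * norm v"
      by (rule cmod_cinner_le)
    also have "\<dots> \<le> (C * 1) * 1"
      using C(2)[of u] mult_left_mono[OF that(1) C(1)] C(1) that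
      by (intro mult_mono) auto
    finally show ?thesis
      by simp
  qed
  show ?thesis
  proof
    fix x p q :: 'a and e :: real
    assume x: "norm x = 1" and px: "cinner p x = 0" and qx: "cinner q x = 0"
      and p: "norm p \<le> 1" and q: "norm q \<le> 1" and e: "0 < e"
      and near: "h - e\<^sup>2 \<le> Re (cinner (A x) x)"
    define X Y where "X = x + of_real e *\<^sub>C p" and "Y = x + of_real e *\<^sub>C q"
    have "Re (cinner (A X) Y) \<le> h + (C\<^sup>2 / h + C) * e\<^sup>2"
    proof (rule rank_one_dominatedD[OF A(2)])
      show "0 \<le> h + (C\<^sup>2 / h + C) * e\<^sup>2"
        using h C(1) by simp
      fix u z :: 'a assume u: "norm u = 1" and z: "norm z = 1"
      \<comment> \<open>Here \<open>cnj \<zeta>\<close> is the coordinate of \<open>z\<close> along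
        \<open>x\<close> and \<open>k\<close> the length of the orthogonal rest.\<close>
      define a \<zeta> k where "a = cinner (A u) u" and "\<zeta> = cinner x z"
        and "k = norm (z - cinner z x *\<^sub>C x)"
      have zx: "cinner z x = cnj \<zeta>"
        unfolding \<zeta>_def by (rule cinner_commute)
      have xx: "cinner x x = 1" "cinner z z = 1"
        by (simp_all add: cinner_self x z)
      have "cinner (z - cinner z x *\<^sub>C x) (z - cinner z x *\<^sub>C x) = 1 - \<zeta> * cnj \<zeta>"
        by (simp add: cinner_simps xx zx \<zeta>_def[symmetric] algebra_simps)
      then have "complex_of_real (k\<^sup>2) = of_real (1 - (cmod \<zeta>)\<^sup>2)"
        unfolding cinner_self k_def[symmetric]
        by (simp only: of_real_diff of_real_1 complex_norm_square)
      then have k: "k\<^sup>2 = 1 - (cmod \<zeta>)\<^sup>2"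
        unfolding of_real_eq_iff .
      have "0 \<le> k"
        by (simp add: k_def)
      have "k\<^sup>2 \<le> 1"
        unfolding k by simp
      have \<zeta>1: "cmod \<zeta> \<le> 1"
        using cmod_cinner_le[of x z] by (simp add: \<zeta>_def x z)
      have xq: "cinner x q = 0" "cinner x p = 0"
        using px qx cinner_commute[of x] by simp_all
      have orth: "cmod (cinner z v) \<le> k" if "cinner x v = 0" "norm v \<le> 1" for v
      proof -
        have "cinner z v = cinner (z - cinner z x *\<^sub>C x) v"
          using that(1) by (simp add: cinner_simps)
        also have "cmod \<dots> \<le> k * norm v"
          unfolding k_def by (rule cmod_cinner_le)
        also have "\<dots> \<le> k * 1"
          using \<open>0 \<le> k\<close> that(2) by (intro mult_left_mono) auto
        finally show ?thesis
          by simp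
      qed
      have zq: "cmod (cinner z q) \<le> k" and pz: "cmod (cinner p z) \<le> k"
        using orth[OF xq(1) q] orth[OF xq(2) p] cinner_commute[of p z] by simp_all
      \<comment> \<open>As \<open>p\<close> and \<open>q\<close> are orthogonal to \<open>x\<close>,
        the terms of \<open>r\<close> that are linear in \<open>e\<close> carry a factor bounded by
        \<open>k\<close>.\<close>
      define r where "r = e * (\<zeta> * cinner z q) + e * (cnj \<zeta> * cinner p z)
        + e\<^sup>2 * (cinner z q * cinner p z)"
      have b: "cinner z Y * cinner X z = (cmod \<zeta>)\<^sup>2 + r"
        using complex_norm_square[of \<zeta>]
        by (simp add: X_def Y_def r_def cinner_simps zx \<zeta>_def[symmetric] power2_eq_square
            algebra_simps)
      have "cmod \<zeta> * cmod (cinner z q) \<le> 1 * k" "cmod \<zeta> * cmod (cinner p z) \<le> 1 * k"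
        by (rule mult_mono[OF \<zeta>1 zq] mult_mono[OF \<zeta>1 pz]; simp)+
      then have "cmod r \<le> e * (1 * k) + e * (1 * k) + e\<^sup>2 * (k * k)"
        unfolding r_def
        by (intro order_trans[OF norm_triangle_ineq] add_mono)
          (use e \<open>0 \<le> k\<close> in \<open>auto simp: norm_mult norm_power intro!: mult_left_mono mult_mono[OF zq pz]\<close>)
      also have "\<dots> \<le> 2 * e * k + e\<^sup>2"
        using mult_left_mono[OF \<open>k\<^sup>2 \<le> 1\<close>, of "e\<^sup>2"] by (simp add: power2_eq_square)
      finally have r: "cmod r \<le> 2 * e * k + e\<^sup>2" .
      have "Re (a * (cinner z Y * cinner X z)) = (cmod \<zeta>)\<^sup>2 * Re a + Re (a * r)"
        unfolding b by (simp add: algebra_simps)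
      also have "(cmod \<zeta>)\<^sup>2 * Re a \<le> (1 - k\<^sup>2) * h"
        using max[OF u] unfolding k a_def by (simp add: mult_left_mono)
      also have "Re (a * r) \<le> C * (2 * e * k + e\<^sup>2)"
      proof -
        have "Re (a * r) \<le> cmod a * cmod r"
          by (metis complex_Re_le_cmod norm_mult)
        also have "\<dots> \<le> C * (2 * e * k + e\<^sup>2)"
          unfolding a_def using CA[of u u] u r C(1) by (intro mult_mono) auto
        finally show ?thesis .
      qed
      \<comment> \<open>Completing the square: the loss \<open>k\<^sup>2 * h\<close> absorbs the
        mixed term \<open>2 * C * e * k\<close> up to
        \<open>C\<^sup>2 / h * e\<^sup>2\<close>.\<close>
      also have "(1 - k\<^sup>2) * h + C * (2 * e * k + e\<^sup>2) \<le> h + (C\<^sup>2 / h + C) * e\<^sup>2"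
      proof -
        have "0 \<le> (k * h - C * e)\<^sup>2 / h"
          using h by simp
        also have "\<dots> = k\<^sup>2 * h - 2 * C * e * k + C\<^sup>2 / h * e\<^sup>2"
          using h by (simp add: field_simps power2_eq_square)
        finally show ?thesis
          by (simp add: algebra_simps)
      qed
      finally show "Re (cinner (A u) u * (cinner z Y * cinner X z)) \<le> h + (C\<^sup>2 / h + C) * e\<^sup>2"
        by (simp add: a_def)
    qed
    moreover have "Re (cinner (A X) Y) = Re (cinner (A x) x) + e * Re (cinner (A p) x + cinner (A x) q)
        + e\<^sup>2 * Re (cinner (A p) q)"
      by (simp add: X_def Y_def bounded_clinear_add[OF A(1)] bounded_clinear_scaleC[OF A(1)]
          cinner_simps power2_eq_square algebra_simps)
    moreover have "e\<^sup>2 * - C \<le> e\<^sup>2 * Re (cinner (A p) q)"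
      using CA[OF p q] abs_Re_le_cmod[of "cinner (A p) q"] by (intro mult_left_mono) auto
    ultimately have "e * Re (cinner (A p) x + cinner (A x) q) \<le> e * ((1 + C\<^sup>2 / h + 2 * C) * e)"
      using near by (simp add: algebra_simps power2_eq_square)
    then show "Re (cinner (A p) x + cinner (A x) q) \<le> (1 + C\<^sup>2 / h + 2 * C) * e"
      using e by (simp only: mult_le_cancel_left_pos)
  qed
qed

text \<open>The residual is the component of \<open>A x\<close> orthogonal to \<open>x\<close>, so
  after normalization it is an admissible direction \<open>q\<close> in the perturbation
  estimate.\<close>

lemma cinner_residual:
  fixes A :: "'a::complex_inner \<Rightarrow> 'a"
  assumes "norm x = 1"
  shows "cinner (A x - cinner (A x) x *\<^sub>C x) x = 0"
    and "cinner (A x) (A x - cinner (A x) x *\<^sub>C x) = (norm (A x - cinner (A x) x *\<^sub>C x))\<^sup>2"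
proof -
  define v where "v = A x - cinner (A x) x *\<^sub>C x"
  show vx: "cinner v x = 0"
    by (simp add: v_def cinner_simps cinner_self assms)
  have "cinner x v = 0"
    using vx cinner_commute[of x v] by simp
  moreover have "A x = v + cinner (A x) x *\<^sub>C x"
    by (simp add: v_def)
  ultimately have "cinner (A x) v = cinner v v"
    by (metis add.right_neutral cinner_add_left cinner_scaleC_left mult_zero_right)
  then show "cinner (A x) v = (norm v)\<^sup>2"
    by (simp add: cinner_self)
qed

text \<open>The estimate is used with \<open>p = 0\<close> and the normalized residual as
  \<open>q\<close>; its left side is then the norm of the residual.\<close>

lemma near_maximizer_residual:
  fixes A :: "'a::complex_inner \<Rightarrow> 'a"
  assumes A: "bounded_clinear A" "rank_one_dominated A" and h: "0 < h"
    and max: "\<And>u. norm u = 1 \<Longrightarrow> Re (cinner (A u) u) \<le> h"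
  obtains K where "\<And>x e. \<lbrakk>norm x = 1; 0 < e; h - e\<^sup>2 \<le> Re (cinner (A x) x)\<rbrakk> \<Longrightarrow>
    norm (A x - cinner (A x) x *\<^sub>C x) \<le> K * e"
proof -
  obtain K where K: "\<And>x p q e. \<lbrakk>norm x = 1; cinner p x = 0; cinner q x = 0; norm p \<le> 1; norm q \<le> 1;
    0 < e; h - e\<^sup>2 \<le> Re (cinner (A x) x)\<rbrakk> \<Longrightarrow> Re (cinner (A p) x + cinner (A x) q) \<le> K * e"
    using near_maximizer_estimate[OF A h max] by blast
  show ?thesis
  proof
    fix x :: 'a and e :: real
    assume x: "norm x = 1" "0 < e" "h - e\<^sup>2 \<le> Re (cinner (A x) x)"
    define v where "v = A x - cinner (A x) x *\<^sub>C x"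
    define q where "q = of_real (inverse (norm v)) *\<^sub>C v"
    note res = cinner_residual[OF x(1), of A, folded v_def]
    have "cinner q x = 0"
      by (simp add: q_def cinner_simps res(1))
    moreover have "norm q \<le> 1"
      by (cases "v = 0") (simp_all add: q_def norm_inverse)
    ultimately have "Re (cinner (A 0) x + cinner (A x) q) \<le> K * e"
      using x by (intro K) auto
    then show "norm v \<le> K * e"
      by (auto simp: bounded_clinear_zero[OF A(1)] q_def cinner_simps res(2) power2_eq_square
          split: if_splits)
  qed
qed

text \<open>An exact maximizer satisfies the estimates for every \<open>e > 0\<close> with one
  constant, so \<open>e\<close> can tend to \<open>0\<close>. The second claim says that the
  complement of \<open>x\<close> is invariant, that is, \<open>x\<close> is also an eigenvector of
  the adjoint.\<close>

lemma maximizer_eigenvector: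
  fixes A :: "'a::complex_inner \<Rightarrow> 'a"
  assumes A: "bounded_clinear A" "rank_one_dominated A" and pos: "0 < Re (cinner (A x) x)"
    and x: "norm x = 1"
    and max: "\<And>u. norm u = 1 \<Longrightarrow> Re (cinner (A u) u) \<le> Re (cinner (A x) x)"
  shows "A x = cinner (A x) x *\<^sub>C x" and "cinner p x = 0 \<Longrightarrow> cinner (A p) x = 0"
proof -
  obtain K where K: "\<And>y p q e. \<lbrakk>norm y = 1; cinner p y = 0; cinner q y = 0; norm p \<le> 1; norm q \<le> 1;
    0 < e; Re (cinner (A x) x) - e\<^sup>2 \<le> Re (cinner (A y) y)\<rbrakk> \<Longrightarrow>
    Re (cinner (A p) y + cinner (A y) q) \<le> K * e"
    using near_maximizer_estimate[OF A pos max] by blast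
  have le0: "r \<le> 0" if "\<And>e. 0 < e \<Longrightarrow> r \<le> L * e" for r L :: real
  proof (rule tendsto_lowerbound)
    show "((\<lambda>e. L * e) \<longlongrightarrow> 0) (at_right 0)"
      by (auto intro!: tendsto_eq_intros)
    show "\<forall>\<^sub>F e in at_right 0. r \<le> L * e"
      using that by (auto simp: eventually_at_right_less intro: eventually_mono[OF eventually_at_right_less])
  qed simp
  have "norm (A x - cinner (A x) x *\<^sub>C x) \<le> 0"
  proof -
    obtain L where L: "\<And>y e. \<lbrakk>norm y = 1; 0 < e; Re (cinner (A x) x) - e\<^sup>2 \<le> Re (cinner (A y) y)\<rbrakk> \<Longrightarrow>
        norm (A y - cinner (A y) y *\<^sub>C y) \<le> L * e"
      using near_maximizer_residual[OF A pos max] by blast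
    show ?thesis
      by (rule le0[of _ L]) (use L x in simp)
  qed
  then show "A x = cinner (A x) x *\<^sub>C x"
    by simp
  show "cinner (A p) x = 0" if "cinner p x = 0"
  proof (rule ccontr)
    define w where "w = cinner (A p) x"
    assume "cinner (A p) x \<noteq> 0"
    then have w: "w \<noteq> 0" and "p \<noteq> 0"
      using bounded_clinear_zero[OF A(1)] by (auto simp: w_def)
    \<comment> \<open>The scalar normalizes \<open>p\<close> and rotates its phase so that
      \<open>cinner (A q) x\<close> becomes the positive number
      \<open>cmod w / norm p\<close>.\<close>
    define q where "q = (cnj w / of_real (cmod w * norm p)) *\<^sub>C p"
    have "Re (cinner (A q) x + cinner (A x) 0) \<le> 0"
      using that w \<open>p \<noteq> 0\<close>
      by (intro le0[of _ K] K) (auto simp: q_def cinner_simps x norm_divide norm_mult)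
    moreover have "cinner (A q) x = w * cnj w / of_real (cmod w * norm p)"
      by (simp add: q_def bounded_clinear_scaleC[OF A(1)] cinner_simps w_def[symmetric])
    then have "cinner (A q) x = of_real (cmod w / norm p)"
      unfolding complex_norm_square[symmetric] by (simp add: power2_eq_square)
    ultimately show False
      using w \<open>p \<noteq> 0\<close> by (simp add: divide_le_0_iff)
  qed
qed

text \<open>Along a maximizing sequence the residuals tend to \<open>0\<close> and, for a
  subsequence, the values of the form tend to some \<open>\<mu>\<close>. Its real part is at least
  the supremum, so \<open>\<mu> \<noteq> 0\<close> and compactness yields an eigenvector.\<close>

lemma attained_maximum_eigenvector:
  fixes A :: "'a::complex_inner \<Rightarrow> 'a"
  assumes A: "compact_op A" "rank_one_dominated A"
    and pos: "norm u = 1" "0 < Re (cinner (A u) u)"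
  obtains x \<mu> where "norm x = 1" "A x = \<mu> *\<^sub>C x" "cinner (A x) x = \<mu>"
    "\<And>u. norm u = 1 \<Longrightarrow> Re (cinner (A u) u) \<le> Re \<mu>"
proof -
  note cl = compact_op_bounded_clinear[OF A(1)]
  define R where "R = (\<lambda>v. Re (cinner (A v) v)) ` {v. norm v = 1}"
  define h where "h = Sup R"
  obtain C where C: "0 \<le> C" "\<And>x. norm (A x) \<le> C * norm x"
    using bounded_clinear_bound[OF cl] by blast
  have CW: "cmod (cinner (A v) v) \<le> C" if "norm v = 1" for v
    using cmod_cinner_le[of "A v" v] C(2)[of v] that by simp
  have "bdd_above R"
    unfolding R_def using CW complex_Re_le_cmod order_trans by (intro bdd_aboveI2[where M = C]) blast
  then have max: "Re (cinner (A v) v) \<le> h" if "norm v = 1" for v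
    unfolding h_def using that by (intro cSup_upper) (auto simp: R_def)
  then have "0 < h"
    using pos by fastforce
  obtain K where K: "\<And>x e. \<lbrakk>norm x = 1; 0 < e; h - e\<^sup>2 \<le> Re (cinner (A x) x)\<rbrakk> \<Longrightarrow>
    norm (A x - cinner (A x) x *\<^sub>C x) \<le> K * e"
    using near_maximizer_residual[OF cl A(2) \<open>0 < h\<close> max] by blast
  \<comment> \<open>The squared gap matches the residual estimate with
    \<open>e = inverse (Suc n)\<close>.\<close>
  have "\<exists>x. norm x = 1 \<and> h - (inverse (Suc n))\<^sup>2 < Re (cinner (A x) x)" for n
    using less_cSupD[of R "h - (inverse (Suc n))\<^sup>2"] pos
    unfolding h_def R_def by (auto simp del: of_nat_Suc)
  then obtain f where f: "norm (f n) = 1" "h - (inverse (Suc n))\<^sup>2 < Re (cinner (A (f n)) (f n))"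
    for n :: nat
    by metis
  have "bounded (range (\<lambda>n. cinner (A (f n)) (f n)))"
    using CW f(1) by (auto simp: bounded_iff)
  then obtain \<mu> s where s: "strict_mono (s :: nat \<Rightarrow> nat)"
    and \<mu>: "(\<lambda>n. cinner (A (f (s n))) (f (s n))) \<longlonglongrightarrow> \<mu>"
    using bounded_imp_convergent_subsequence[of "\<lambda>n. cinner (A (f n)) (f n)"] by (auto simp: o_def)
  have inv0: "(\<lambda>n. inverse (real (Suc (s n)))) \<longlonglongrightarrow> 0"
    using LIMSEQ_subseq_LIMSEQ[OF LIMSEQ_inverse_real_of_nat s] by (simp add: o_def)
  have "h - 0\<^sup>2 \<le> Re \<mu>"
  proof (rule LIMSEQ_le)
    show "(\<lambda>n. h - (inverse (real (Suc (s n))))\<^sup>2) \<longlonglongrightarrow> h - 0\<^sup>2"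
      by (intro tendsto_diff tendsto_power tendsto_const inv0)
    show "(\<lambda>n. Re (cinner (A (f (s n))) (f (s n)))) \<longlonglongrightarrow> Re \<mu>"
      by (rule tendsto_Re[OF \<mu>])
  qed (use f(2) less_imp_le in blast)
  then have h\<mu>: "h \<le> Re \<mu>"
    by simp
  then have "\<mu> \<noteq> 0"
    using \<open>0 < h\<close> by auto
  have "(\<lambda>n. A (f (s n)) - cinner (A (f (s n))) (f (s n)) *\<^sub>C f (s n)) \<longlonglongrightarrow> 0"
  proof (rule Lim_null_comparison[OF always_eventually])
    show "\<forall>n. norm (A (f (s n)) - cinner (A (f (s n))) (f (s n)) *\<^sub>C f (s n))
        \<le> K * inverse (real (Suc (s n)))"
      by (intro allI K f less_imp_le) simp
    show "(\<lambda>n. K * inverse (real (Suc (s n)))) \<longlonglongrightarrow> 0"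
      using tendsto_mult_left[OF inv0, of K] by simp
  qed
  then obtain x where x: "norm x = 1" "A x = \<mu> *\<^sub>C x"
    using compact_op_approx_eigenvector[OF A(1) f(1) _ \<mu> \<open>\<mu> \<noteq> 0\<close>] by blast
  show ?thesis
  proof
    show "cinner (A x) x = \<mu>"
      by (simp add: x cinner_simps cinner_self)
    show "Re (cinner (A v) v) \<le> Re \<mu>" if "norm v = 1" for v
      using max[OF that] h\<mu> by linarith
  qed (fact x)+
qed

text \<open>Subtracting from \<open>y\<close> its projection onto \<open>x\<close> gives a vector in
  the invariant complement; pairing its image with \<open>x\<close> leaves
  \<open>(\<nu> - \<mu>) * cinner y x = 0\<close>.\<close>

lemma eigenvectors_orthogonal:
  fixes A :: "'a::complex_inner \<Rightarrow> 'a"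
  assumes A: "bounded_clinear A" and x: "norm x = 1" "A x = \<mu> *\<^sub>C x"
    and red: "\<And>p. cinner p x = 0 \<Longrightarrow> cinner (A p) x = 0"
    and y: "A y = \<nu> *\<^sub>C y" "\<nu> \<noteq> \<mu>"
  shows "cinner y x = 0"
proof -
  have xx: "cinner x x = 1"
    by (simp add: cinner_self x)
  have "cinner (A (y - cinner y x *\<^sub>C x)) x = 0"
    by (intro red) (simp add: cinner_simps xx)
  then have "(\<nu> - \<mu>) * cinner y x = 0"
    by (simp add: bounded_clinear_diff[OF A] bounded_clinear_scaleC[OF A] x(2) y(1) cinner_simps xx
        algebra_simps)
  then show ?thesis
    using y(2) by simp
qed

section \<open>Numerical radius 1 attained at the eigenvalue 1\<close>

context
  fixes A :: "'a::complex_inner \<Rightarrow> 'a" and x\<^sub>0 :: 'a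
  assumes A: "compact_op A" "rank_one_dominated A"
    and x\<^sub>0: "norm x\<^sub>0 = 1" "A x\<^sub>0 = x\<^sub>0"
    and radius: "\<And>u. norm u = 1 \<Longrightarrow> cmod (cinner (A u) u) \<le> 1"
begin

text \<open>The radius bound makes \<open>x\<^sub>0\<close> a maximizer of the real part, so its
  complement is invariant.\<close>

lemma eigenvector_orthogonal_top:
  assumes "A y = \<nu> *\<^sub>C y" "\<nu> \<noteq> 1"
  shows "cinner y x\<^sub>0 = 0"
proof (rule eigenvectors_orthogonal[OF compact_op_bounded_clinear[OF A(1)] x\<^sub>0(1) _ _ assms])
  show "cinner (A p) x\<^sub>0 = 0" if "cinner p x\<^sub>0 = 0" for p
  proof (rule maximizer_eigenvector(2)[OF compact_op_bounded_clinear[OF A(1)] A(2) _ x\<^sub>0(1) _ that])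
    show "Re (cinner (A u) u) \<le> Re (cinner (A x\<^sub>0) x\<^sub>0)" if "norm u = 1" for u
      using radius[OF that] complex_Re_le_cmod[of "cinner (A u) u"] by (simp add: x\<^sub>0 cinner_self)
  qed (simp add: x\<^sub>0 cinner_self)
qed (simp add: x\<^sub>0)

text \<open>
  An eigenvector \<open>x\<close> with eigenvalue of negative real part is orthogonal to \<open>x\<^sub>0\<close>, so the numerical
  range of the operator \<open>(x\<^sub>0 + x) \<otimes> (x\<^sub>0 - x)\<close> lies in the unit disc.
\<close>

lemma Re_quadratic_nonneg:
  assumes u: "norm u = 1"
  shows "0 \<le> Re (cinner (A u) u)"
proof (rule ccontr)
  assume neg: "\<not> 0 \<le> Re (cinner (A u) u)"
  note cl = compact_op_bounded_clinear[OF A(1)]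
  have pos: "0 < Re (cinner ((-1) *\<^sub>C A u) u)"
    using neg by (simp add: cinner_scaleC_left)
  obtain x \<nu> where x: "norm x = 1" "(-1) *\<^sub>C A x = \<nu> *\<^sub>C x"
    and max: "\<And>u. norm u = 1 \<Longrightarrow> Re (cinner ((-1) *\<^sub>C A u) u) \<le> Re \<nu>"
    using attained_maximum_eigenvector[OF compact_op_scale[OF A(1), of "-1"]
        rank_one_dominated_scale[OF A(2), of "-1"] u pos] by blast
  have "0 < Re \<nu>"
    using max[OF u] neg by (simp add: cinner_simps)
  have Ax: "A x = (- \<nu>) *\<^sub>C x"
    using arg_cong[OF x(2), of "scaleC (-1)"] by (simp add: scaleC_scaleC)
  have orth: "cinner x x\<^sub>0 = 0"
    by (rule eigenvector_orthogonal_top[OF Ax]) (use \<open>0 < Re \<nu>\<close> in \<open>auto simp: complex_eq_iff\<close>)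
  then have orth': "cinner x\<^sub>0 x = 0"
    using cinner_commute[of x\<^sub>0 x] by simp
  have "Re (cinner (A (x\<^sub>0 + x)) (x\<^sub>0 - x)) \<le> 1"
  proof (rule rank_one_dominatedD[OF A(2)])
    fix v z :: 'a assume v: "norm v = 1" and z: "norm z = 1"
    define a b where "a = cinner z x\<^sub>0" and "b = cinner z x"
    have unit: "cinner x\<^sub>0 x\<^sub>0 = 1" "cinner x x = 1" "cinner z z = 1"
      by (simp_all add: cinner_self x\<^sub>0(1) x(1) z)
    have ab: "cinner x\<^sub>0 z = cnj a" "cinner x z = cnj b"
      unfolding a_def b_def by (rule cinner_commute)+
    have "cinner (z - a *\<^sub>C x\<^sub>0 - b *\<^sub>C x) (z - a *\<^sub>C x\<^sub>0 - b *\<^sub>C x) = 1 - a * cnj a - b * cnj b"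
      by (simp add: cinner_simps orth orth' ab a_def[symmetric] b_def[symmetric] unit algebra_simps)
    then have "complex_of_real ((norm (z - a *\<^sub>C x\<^sub>0 - b *\<^sub>C x))\<^sup>2) =
        of_real (1 - (cmod a)\<^sup>2 - (cmod b)\<^sup>2)"
      by (simp only: cinner_self of_real_diff of_real_1 complex_norm_square)
    then have bessel: "(cmod a)\<^sup>2 + (cmod b)\<^sup>2 \<le> 1"
      unfolding of_real_eq_iff by (smt (verit) zero_le_power2)
    \<comment> \<open>The product is \<open>(a - b) * cnj (a + b)\<close>; its modulus equals that
      of \<open>a\<^sup>2 - b\<^sup>2\<close>, which Bessel's inequality bounds by
      \<open>1\<close>.\<close>
    have "cmod (cinner z (x\<^sub>0 - x) * cinner (x\<^sub>0 + x) z) = cmod (a - b) * cmod (a + b)"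
      using complex_mod_cnj[of "a + b"]
      by (simp add: cinner_simps ab a_def[symmetric] b_def[symmetric] norm_mult)
    also have "\<dots> = cmod (a\<^sup>2 - b\<^sup>2)"
      unfolding norm_mult[symmetric] by (simp add: power2_eq_square algebra_simps)
    also have "\<dots> \<le> 1"
      using norm_triangle_ineq4[of "a\<^sup>2" "b\<^sup>2"] bessel by (simp add: norm_power)
    finally have "cmod (cinner (A v) v * (cinner z (x\<^sub>0 - x) * cinner (x\<^sub>0 + x) z)) \<le> 1 * 1"
      unfolding norm_mult[of "cinner (A v) v"] using radius[OF v] by (intro mult_mono) auto
    then show "Re (cinner (A v) v * (cinner z (x\<^sub>0 - x) * cinner (x\<^sub>0 + x) z)) \<le> 1"
      using complex_Re_le_cmod order_trans by fastforce
  qed simp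
  \<comment> \<open>The sign change in the second vector makes the contributions of \<open>1\<close>
    and of the eigenvalue \<open>- \<nu>\<close> add up, beyond the bound \<open>1\<close>.\<close>
  moreover have "cinner (A (x\<^sub>0 + x)) (x\<^sub>0 - x) = 1 + \<nu>"
    by (simp add: bounded_clinear_add[OF cl] Ax x\<^sub>0 cinner_simps orth orth' cinner_self x(1))
  ultimately show False
    using \<open>0 < Re \<nu>\<close> by simp
qed

text \<open>
  The supporting direction is rotated from \<open>1\<close> towards \<open>e\<close> as long as \<open>1\<close> stays a supporting point of
  the numerical range. Where this stops, the eigenvectors of the new supporting points accumulate
  at an eigenvector of the same maximum that is orthogonal to \<open>x\<^sub>0\<close>. All maximizers being
  eigenvectors, its eigenvalue is \<open>1\<close>, which contradicts the orthogonality of eigenvectors.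
\<close>

lemma quadratic_halfplane:
  assumes e: "Re e = 0" and u: "norm u = 1"
  shows "Re (cnj e * cinner (A u) u) \<le> 0"
proof -
  note cl = compact_op_bounded_clinear[OF A(1)]
  define w where "w t = complex_of_real (1 - t) + of_real t * e" for t :: real
  have Re_w: "Re (cnj (w t)) = 1 - t" for t
    using e by (simp add: w_def)
  have cont_w: "continuous_on UNIV w"
    unfolding w_def by (intro continuous_intros)
  \<comment> \<open>Since \<open>Re (cnj (w t)) = 1 - t\<close>, this is the set of those
    \<open>t\<close> for which the point \<open>1\<close> is still extremal in direction
    \<open>w t\<close>.\<close>
  define S where "S = {0..1} \<inter>
    (\<Inter>u\<in>{u. norm u = 1}. {t. Re (cnj (w t) * cinner (A u) u) \<le> 1 - t})"
  define T where "T = Sup S"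
  have "closed S"
    unfolding S_def
    by (intro closed_Int closed_INT ballI closed_Collect_le continuous_intros cont_w)
  moreover have "0 \<in> S"
    using radius complex_Re_le_cmod order_trans unfolding S_def w_def by fastforce
  moreover have "bdd_above S"
    unfolding S_def by (intro bdd_aboveI[of _ 1]) auto
  ultimately have "T \<in> S"
    unfolding T_def by (intro closed_contains_Sup) auto
  then have T: "0 \<le> T" "T \<le> 1"
    and TS: "\<And>u. norm u = 1 \<Longrightarrow> Re (cnj (w T) * cinner (A u) u) \<le> 1 - T"
    by (auto simp: S_def)
  have "T = 1"
  proof (rule ccontr)
    assume "T \<noteq> 1"
    then have "T < 1"
      using T by simp
    \<comment> \<open>The parameters descend to \<open>T\<close> from \<open>\<tau> 0 = 1\<close>;
      none lies in \<open>S\<close>, so in each direction some other point beats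
      \<open>1\<close>.\<close>
    define \<tau> where "\<tau> n = T + (1 - T) * inverse (real (Suc n))" for n
    have \<tau>_lim: "\<tau> \<longlonglongrightarrow> T"
      using tendsto_add[OF tendsto_const[of T] tendsto_mult_left[OF LIMSEQ_inverse_real_of_nat, of "1 - T"]]
      by (simp add: \<tau>_def[abs_def])
    have "\<exists>x \<nu>. norm x = 1 \<and> A x = \<nu> *\<^sub>C x \<and> 1 - \<tau> n < Re (cnj (w (\<tau> n)) * \<nu>)" for n
    proof -
      have "(1 - T) * inverse (real (Suc n)) \<le> (1 - T) * 1"
        using \<open>T < 1\<close> by (intro mult_left_mono) (auto simp: inverse_eq_divide)
      then have "\<tau> n \<le> T + (1 - T) * 1"
        unfolding \<tau>_def by (rule add_left_mono)
      then have \<tau>1: "\<tau> n \<le> 1"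
        by simp
      have "T < \<tau> n"
        using \<open>T < 1\<close> by (simp add: \<tau>_def)
      then have "\<tau> n \<notin> S"
        using cSup_upper[OF _ \<open>bdd_above S\<close>, of "\<tau> n"] unfolding T_def by auto
      then obtain u where u: "norm u = 1" "1 - \<tau> n < Re (cnj (w (\<tau> n)) * cinner (A u) u)"
        using \<tau>1 \<open>T < \<tau> n\<close> T(1) by (auto simp: S_def not_le)
      have pos: "0 < Re (cinner (cnj (w (\<tau> n)) *\<^sub>C A u) u)"
        using u(2) \<tau>1 unfolding cinner_scaleC_left by linarith
      obtain x \<mu> where x: "norm x = 1" "cnj (w (\<tau> n)) *\<^sub>C A x = \<mu> *\<^sub>C x"
        and max: "\<And>u. norm u = 1 \<Longrightarrow> Re (cinner (cnj (w (\<tau> n)) *\<^sub>C A u) u) \<le> Re \<mu>"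
        using attained_maximum_eigenvector[OF compact_op_scale[OF A(1), of "cnj (w (\<tau> n))"]
            rank_one_dominated_scale[OF A(2), of "cnj (w (\<tau> n))"] u(1) pos] by blast
      have \<mu>: "1 - \<tau> n < Re \<mu>"
        using max[OF u(1)] u(2) by (simp add: cinner_scaleC_left)
      have wn: "cnj (w (\<tau> n)) \<noteq> 0"
      proof
        assume "cnj (w (\<tau> n)) = 0"
        then have "\<mu> = 0"
          using x by auto
        then show False
          using \<mu> \<tau>1 by simp
      qed
      have "A x = (\<mu> / cnj (w (\<tau> n))) *\<^sub>C x"
        using arg_cong[OF x(2), of "scaleC (inverse (cnj (w (\<tau> n))))"] wn
        by (simp add: scaleC_scaleC field_simps)
      moreover have "cnj (w (\<tau> n)) * (\<mu> / cnj (w (\<tau> n))) = \<mu>"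
        using wn by simp
      ultimately show ?thesis
        using x(1) \<mu> by metis
    qed
    then obtain f \<nu> where f: "\<And>n. norm (f n) = 1" "\<And>n. A (f n) = \<nu> n *\<^sub>C f n"
      and \<nu>: "\<And>n. 1 - \<tau> n < Re (cnj (w (\<tau> n)) * \<nu> n)"
      by metis
    \<comment> \<open>The eigenvalue \<open>1\<close> would give exactly
      \<open>1 - \<tau> n\<close>, not more.\<close>
    have \<nu>1: "\<nu> n \<noteq> 1" for n
      using \<nu>[of n] Re_w[of "\<tau> n"] by auto
    have "cmod (\<nu> n) \<le> 1" for n
      using radius[OF f(1)[of n]] by (simp add: f cinner_simps cinner_self)
    then have "bounded (range \<nu>)"
      by (auto simp: bounded_iff)
    then obtain \<mu> s where s: "strict_mono (s :: nat \<Rightarrow> nat)" and \<mu>: "(\<lambda>n. \<nu> (s n)) \<longlonglongrightarrow> \<mu>"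
      using bounded_imp_convergent_subsequence[of \<nu>] by (auto simp: o_def)
    have \<tau>s: "(\<lambda>n. \<tau> (s n)) \<longlonglongrightarrow> T"
      using LIMSEQ_subseq_LIMSEQ[OF \<tau>_lim s] by (simp add: o_def)
    have "1 - T \<le> Re (cnj (w T) * \<mu>)"
    proof (rule LIMSEQ_le)
      show "(\<lambda>n. 1 - \<tau> (s n)) \<longlonglongrightarrow> 1 - T"
        by (intro tendsto_diff tendsto_const \<tau>s)
      have "(\<lambda>n. w (\<tau> (s n))) \<longlonglongrightarrow> w T"
        using continuous_on_tendsto_compose[OF cont_w \<tau>s] by simp
      then show "(\<lambda>n. Re (cnj (w (\<tau> (s n))) * \<nu> (s n))) \<longlonglongrightarrow> Re (cnj (w T) * \<mu>)"
        by (intro tendsto_Re tendsto_mult tendsto_cnj \<mu>)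
    qed (use \<nu> less_imp_le in blast)
    then have "\<mu> \<noteq> 0" and wT: "w T \<noteq> 0"
      using \<open>T < 1\<close> by auto
    have "(\<lambda>n. A (f (s n)) - \<nu> (s n) *\<^sub>C f (s n)) \<longlonglongrightarrow> 0"
      by (simp add: f)
    then obtain r y where r: "strict_mono (r :: nat \<Rightarrow> nat)" and lim: "(\<lambda>n. f (s (r n))) \<longlonglongrightarrow> y"
      and y: "norm y = 1" "A y = \<mu> *\<^sub>C y"
      using compact_op_approx_eigenvector[OF A(1) f(1) _ \<mu> \<open>\<mu> \<noteq> 0\<close>] by blast
    have "cinner (f n) x\<^sub>0 = 0" for n
      by (rule eigenvector_orthogonal_top[OF f(2) \<nu>1])
    then have yx: "cinner y x\<^sub>0 = 0"
      using tendsto_cinner[OF lim tendsto_const[of x\<^sub>0]] by (simp add: LIMSEQ_const_iff)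
    then have xy: "cinner x\<^sub>0 y = 0"
      using cinner_commute[of x\<^sub>0 y] by simp
    have xx: "cinner x\<^sub>0 x\<^sub>0 = 1" "cinner y y = 1"
      by (simp_all add: cinner_self x\<^sub>0 y)
    define A' where "A' v = cnj (w T) *\<^sub>C A v" for v
    have A': "bounded_clinear A'" "rank_one_dominated A'"
      unfolding A'_def by (rule bounded_clinear_scale[OF cl] rank_one_dominated_scale[OF A(2)])+
    have max: "Re (cinner (A' v) v) \<le> 1 - T" if "norm v = 1" for v
      using TS[OF that] by (simp only: A'_def cinner_scaleC_left)
    have qy: "cinner (A' y) y = cnj (w T) * \<mu>"
      by (simp add: A'_def y(2) cinner_simps xx)
    have Re\<mu>: "Re (cnj (w T) * \<mu>) = 1 - T"
      using max[OF y(1)] \<open>1 - T \<le> Re (cnj (w T) * \<mu>)\<close> unfolding qy by linarith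
    \<comment> \<open>Both \<open>x\<^sub>0\<close> and \<open>y\<close> are maximizers for
      \<open>A'\<close>, and they are orthogonal eigenvectors, so \<open>g\<close> is a maximizer as
      well. Being an eigenvector, it forces their eigenvalues to agree.\<close>
    define g where "g = of_real (1 / sqrt 2) *\<^sub>C (x\<^sub>0 + y)"
    have gg: "cinner g g = 1"
      by (simp add: g_def cinner_simps xx xy yx flip: of_real_mult)
    then have g1: "norm g = 1"
      unfolding cinner_self by (metis norm_ge_zero of_real_eq_1_iff power2_eq_1_iff
          le_minus_one_simps(3) not_le)
    have qg: "cinner (A' g) g = (cnj (w T) + cnj (w T) * \<mu>) / 2"
      by (simp add: g_def A'_def bounded_clinear_scaleC[OF cl] bounded_clinear_add[OF cl] x\<^sub>0 y
          cinner_simps xx xy yx scaleC_add_right algebra_simps flip: of_real_mult)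
    have Re_g: "Re (cinner (A' g) g) = 1 - T"
      unfolding qg using Re\<mu> Re_w[of T] by simp
    have "A' g = cinner (A' g) g *\<^sub>C g"
      by (rule maximizer_eigenvector(1)[OF A' _ g1]) (use Re_g \<open>T < 1\<close> max in auto)
    then have "of_real (sqrt 2) *\<^sub>C A' g = of_real (sqrt 2) *\<^sub>C cinner (A' g) g *\<^sub>C g"
      by simp
    then have eig: "cnj (w T) *\<^sub>C (x\<^sub>0 + \<mu> *\<^sub>C y) = cinner (A' g) g *\<^sub>C (x\<^sub>0 + y)"
      by (simp add: g_def A'_def bounded_clinear_scaleC[OF cl] bounded_clinear_add[OF cl] x\<^sub>0 y
          scaleC_scaleC)
    have "cnj (w T) = cinner (A' g) g" "cnj (w T) * \<mu> = cinner (A' g) g"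
      using arg_cong[OF eig, of "\<lambda>v. cinner v x\<^sub>0"] arg_cong[OF eig, of "\<lambda>v. cinner v y"]
      by (simp_all add: cinner_simps xx xy yx)
    then have \<mu>1: "\<mu> = 1"
      using wT by (metis complex_cnj_zero_iff mult_cancel_left1)
    have red: "cinner (A p) y = 0" if "cinner p y = 0" for p
    proof -
      have "cinner (A' p) y = 0"
        by (rule maximizer_eigenvector(2)[OF A' _ y(1) _ that])
          (use qy Re\<mu> max \<open>T < 1\<close> in auto)
      then show ?thesis
        using wT by (simp add: A'_def cinner_simps)
    qed
    \<comment> \<open>Now \<open>y\<close> has eigenvalue \<open>1\<close> and an invariant
      complement, whereas \<open>\<nu> n \<noteq> 1\<close>; yet a subsequence of \<open>f\<close>
      converges to \<open>y\<close>.\<close>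
    have "cinner (f n) y = 0" for n
      by (rule eigenvectors_orthogonal[OF cl y red f(2)]) (use \<nu>1 \<mu>1 in auto)
    then have "cinner y y = 0"
      using tendsto_cinner[OF lim tendsto_const[of y]] by (simp add: LIMSEQ_const_iff)
    then show False
      using xx by simp
  qed
  then show ?thesis
    using TS[OF u] by (simp add: w_def)
qed

text \<open>The half-planes for \<open>\<i>\<close> and \<open>-\<i>\<close> together make the
  quadratic form real.\<close>

lemma positive_semidefinite_of_top_eigenvalue: "positive_semidefinite_op A"
  unfolding positive_semidefinite_op_def
proof (intro conjI allI)
  note cl = compact_op_bounded_clinear[OF A(1)]
  show "bounded_clinear A"
    by (rule cl)
  have unit: "cinner (A u) u \<in> \<real>\<^sub>\<ge>\<^sub>0" if "norm u = 1" for u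
    using Re_quadratic_nonneg[OF that] quadratic_halfplane[of \<i>, OF _ that]
      quadratic_halfplane[of "-\<i>", OF _ that]
    by (simp add: complex_nonneg_Reals_iff)
  show "cinner (A x) x \<in> \<real>\<^sub>\<ge>\<^sub>0" for x
  proof (cases "x = 0")
    case False
    then have "cinner (A x) x / (norm x)\<^sup>2 \<in> \<real>\<^sub>\<ge>\<^sub>0"
      using cinner_quotient_in_numerical_range[OF cl False] unit by (auto simp: numerical_range_def)
    then have "cinner (A x) x / (norm x)\<^sup>2 * of_real ((norm x)\<^sup>2) \<in> \<real>\<^sub>\<ge>\<^sub>0"
      by (rule nonneg_Reals_mult_I) simp
    then show ?thesis
      using False by simp
  qed simp
qed

end

section \<open>Normalization of the operator\<close>

text \<open>Unless the form vanishes, \<open>A\<close> is divided by a point \<open>\<mu>\<close> of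
  largest modulus in the closure of its numerical range. The quotient has numerical radius 1, and
  its largest real part is attained at an eigenvalue that can only be \<open>1\<close>.\<close>

lemma multiple_of_positive_semidefinite:
  fixes A :: "'a::complex_inner \<Rightarrow> 'a"
  assumes A: "compact_op A" "rank_one_dominated A"
  shows "\<exists>\<gamma> P. positive_semidefinite_op P \<and> A = (\<lambda>x. \<gamma> *\<^sub>C P x)"
proof (cases "numerical_range A \<subseteq> {0}")
  note cl = compact_op_bounded_clinear[OF A(1)]
  case True
  have "cinner (A x) x = 0" for x
    using True cinner_quotient_in_numerical_range[OF cl, of x] by (cases "x = 0") auto
  then have "positive_semidefinite_op A"
    by (simp add: positive_semidefinite_op_def cl)
  then show ?thesis
    by (intro exI[of _ 1] exI[of _ A]) simp
next
  note cl = compact_op_bounded_clinear[OF A(1)]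
  case False
  obtain C where C: "0 \<le> C" "\<And>x. norm (A x) \<le> C * norm x"
    using bounded_clinear_bound[OF cl] by blast
  have "cmod (cinner (A v) v) \<le> C" if "norm v = 1" for v
    using cmod_cinner_le[of "A v" v] C(2)[of v] that by simp
  then have "bounded (numerical_range A)"
    by (auto simp: bounded_iff numerical_range_def)
  then have "compact (closure (numerical_range A))" "closure (numerical_range A) \<noteq> {}"
    using False by (auto simp: compact_closure)
  then obtain \<mu> where \<mu>: "\<mu> \<in> closure (numerical_range A)"
    and top: "\<And>z. z \<in> closure (numerical_range A) \<Longrightarrow> cmod z \<le> cmod \<mu>"
    using continuous_attains_sup[of "closure (numerical_range A)" cmod]
      continuous_on_norm_id by blast
  have radius: "cmod (cinner (A u) u) \<le> cmod \<mu>" if "norm u = 1" for u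
    using top closure_subset numerical_rangeI[OF that] by blast
  have "\<mu> \<noteq> 0"
    using False radius by (fastforce simp: numerical_range_def)
  define A' where "A' x = inverse \<mu> *\<^sub>C A x" for x
  have A': "compact_op A'" "rank_one_dominated A'"
    unfolding A'_def by (rule compact_op_scale[OF A(1)] rank_one_dominated_scale[OF A(2)])+
  have radius': "cmod (cinner (A' u) u) \<le> 1" if "norm u = 1" for u
    using radius[OF that] \<open>\<mu> \<noteq> 0\<close>
    unfolding A'_def cinner_scaleC_left norm_mult norm_inverse by (simp add: field_simps)
  \<comment> \<open>A point this close to \<open>\<mu>\<close> has
    \<open>Re (inverse \<mu> * z) > 0\<close>, the positivity required for attaining the
    maximum.\<close>
  obtain z where z: "z \<in> numerical_range A" "dist z \<mu> < cmod \<mu>"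
    using \<mu> \<open>\<mu> \<noteq> 0\<close> unfolding closure_approachable by (metis zero_less_norm_iff)
  then obtain u where u: "norm u = 1" "z = cinner (A u) u"
    by (auto simp: numerical_range_def)
  have "cmod (1 - inverse \<mu> * z) < 1"
  proof -
    have "1 - inverse \<mu> * z = inverse \<mu> * (\<mu> - z)"
      using \<open>\<mu> \<noteq> 0\<close> by (simp add: field_simps)
    then show ?thesis
      using z(2) \<open>\<mu> \<noteq> 0\<close> unfolding \<open>1 - inverse \<mu> * z = inverse \<mu> * (\<mu> - z)\<close> norm_mult norm_inverse
      by (simp add: dist_norm norm_minus_commute field_simps)
  qed
  then have "0 < Re (cinner (A' u) u)"
    using complex_Re_le_cmod[of "1 - inverse \<mu> * z"] by (simp add: A'_def cinner_scaleC_left u(2))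
  then obtain x \<nu> where x: "norm x = 1" "A' x = \<nu> *\<^sub>C x" "cinner (A' x) x = \<nu>"
    and max: "\<And>u. norm u = 1 \<Longrightarrow> Re (cinner (A' u) u) \<le> Re \<nu>"
    using attained_maximum_eigenvector[OF A' u(1)] by blast
  \<comment> \<open>The bound must pass to the closure, because \<open>\<mu>\<close> itself is only
    known to lie there.\<close>
  have "closure (numerical_range A) \<subseteq> {z. Re (inverse \<mu> * z) \<le> Re \<nu>}"
  proof (rule closure_minimal)
    show "numerical_range A \<subseteq> {z. Re (inverse \<mu> * z) \<le> Re \<nu>}"
      using max unfolding numerical_range_def A'_def cinner_scaleC_left by blast
    show "closed {z. Re (inverse \<mu> * z) \<le> Re \<nu>}"
      by (intro closed_Collect_le continuous_intros)
  qed
  then have "Re (inverse \<mu> * \<mu>) \<le> Re \<nu>"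
    using \<mu> by blast
  then have "1 \<le> Re \<nu>" "cmod \<nu> \<le> 1"
    using radius'[OF x(1)] \<open>\<mu> \<noteq> 0\<close> by (simp_all add: x(3))
  then have "\<nu> = 1"
    by (smt (verit) abs_Re_le_cmod cmod_eq_Re complex_Re_le_cmod complex_eq_iff cmod_power2
        one_complex.simps power2_less_eq_zero_iff power_one power_mono zero_le_power2)
  then have "positive_semidefinite_op A'"
    using x by (intro positive_semidefinite_of_top_eigenvalue[OF A' x(1) _ radius']) simp_all
  moreover have "A = (\<lambda>x. \<mu> *\<^sub>C A' x)"
    using \<open>\<mu> \<noteq> 0\<close> by (simp add: A'_def scaleC_scaleC)
  ultimately show ?thesis
    by blast
qed

theorem theorem1p2:
  fixes A :: "'h::complex_hilbert_space \<Rightarrow> 'h"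
  assumes "compact_op A"
  shows "((\<exists>\<gamma> P. positive_semidefinite_op P \<and> A = (\<lambda>x. \<gamma> *\<^sub>C P x)) \<longleftrightarrow>
          (\<forall>B. bounded_clinear B \<longrightarrow>
            op_spectrum (A \<circ> B) \<subseteq> closure (numerical_range A * numerical_range B))) \<and>
         ((\<forall>B. bounded_clinear B \<longrightarrow>
            op_spectrum (A \<circ> B) \<subseteq> closure (numerical_range A * numerical_range B)) \<longleftrightarrow>
          (\<forall>B. rank_one_op B \<longrightarrow>
            op_spectrum (A \<circ> B) \<subseteq> closure (numerical_range A * numerical_range B)))"
  (is "(?A1 \<longleftrightarrow> ?A2) \<and> (_ \<longleftrightarrow> ?A3)")
proof -
  have "?A1 \<Longrightarrow> ?A2"
    using op_spectrum_compose_subset assms by blast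
  moreover have "?A2 \<Longrightarrow> ?A3"
    by (simp add: rank_one_op_def)
  moreover have "?A3 \<Longrightarrow> ?A1"
    using multiple_of_positive_semidefinite rank_one_dominatedI compact_op_bounded_clinear assms
    by blast
  ultimately show ?thesis
    by argo
qed

end
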